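(* Let $g\ge 0$ be a fixed integer. Let $\{G_n\}$ be a positive linear recurrence sequence $G_n=c_1G_{n-1}+\cdots+c_LG_{n-L}$ with the additional constraint that all the coefficients $c_1,\dots,c_L$ are positive. Suppose there exists $n_0\in\mathbb{N}$ such that the random variable $K_{g,n}$ is non-trivial (i.e., is not the constant $0$) for all $n\ge n_0$. Let $\sigma_{g,n}^2=\mathrm{Var}[K_{g,n}]$. Then there exist constants $C_{\sigma,g}>0$, $d_{\sigma,g}\in\mathbb{R}$ and $\gamma_{\sigma,g}\in(0,1)$, depending only on $g$, $L$ and the $c_i$'s, such that \[\sigma_{g,n}^2=C_{\sigma,g}\,n+d_{\sigma,g}+O(\gamma_{\sigma,g}^n)\quad (n\to\infty).\]
   Context: A positive linear recurrence sequence (PLRS) is a sequence $\{G_n\}_{n\ge1}$ satisfying $G_n=c_1G_{n-1}+\cdots+c_LG_{n-L}$ (for $n>L$), where the $c_i$ are non-negative integers with $L\ge1$, $c_1\ge1$, $c_L\ge1$, and with initial conditions $G_1=1$ and $G_n=c_1G_{n-1}+c_2G_{n-2}+\cdots+c_{n-1}G_1+1$ for $1\le n\le L$. A decomposition $M=\sum_{i=1}^N a_iG_{N+1-i}$ with $a_1>0$ and $a_i\ge0$ is legal if either (1) $N<L$ and $a_i=c_i$ for $1\le i\le N$, or (2) there is $s\in\{1,\dots,L\}$ with $a_1=c_1,\dots,a_{s-1}=c_{s-1}$, $a_s<c_s$, $a_{s+1}=\cdots=a_{s+\ell}=0$ for some $\ell\ge0$, and the sequence $(b_i)_{i=1}^{N-s-\ell}$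 with $b_i=a_{s+\ell+i}$ is either legal or empty. Every positive integer $M$ has a unique legal decomposition (generalized Zeckendorf theorem). Writing this decomposition as $M=G_{i_1}+G_{i_2}+\cdots+G_{i_k}$ with $i_1\ge i_2\ge\cdots\ge i_k$ (each $G_j$ repeated according to its coefficient), the gaps of $M$ are $i_1-i_2,\,i_2-i_3,\dots,i_{k-1}-i_k$, and $k_g(M)$ denotes the number of gaps equal to $g$. $K_{g,n}$ is the random variable $k_g(M)$ for $M$ chosen uniformly at random from the integers in $[G_n,G_{n+1})$. *)

theory Defs
  imports "HOL-Probability.Probability" "HOL-Library.Landau_Symbols"
begin

text \<open>
  The coefficients \<open>c\<^sub>1, \<dots>, c\<^sub>L\<close> are the list \<open>cs\<close>, so \<open>L = length cs\<close> and \<open>c\<^sub>i = cs ! (i - 1)\<close>;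
  likewise a decomposition with coefficients \<open>a\<^sub>1, \<dots>, a\<^sub>N\<close> is a list \<open>as\<close> of length \<open>N\<close> with
  \<open>a\<^sub>i = as ! (i - 1)\<close>.
\<close>

definition plrs_coeffs :: "nat list \<Rightarrow> bool" where
  "plrs_coeffs cs \<longleftrightarrow> length cs \<ge> 1 \<and> hd cs \<ge> 1 \<and> last cs \<ge> 1"

text \<open>
  The sequence \<open>G\<close>, indexed from 1; the value at 0 is a dummy. For \<open>n = 1\<close> the sum is empty, so
  \<open>G\<^sub>1 = 1\<close>.
\<close>

function plrs :: "nat list \<Rightarrow> nat \<Rightarrow> nat" where
  "plrs cs n =
     (if n = 0 then 0
      else if n \<le> length cs then (\<Sum>i = 1..<n. cs ! (i - 1) * plrs cs (n - i)) + 1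
      else (\<Sum>i = 1..length cs. cs ! (i - 1) * plrs cs (n - i)))"
  by auto
termination
  by (relation "Wellfounded.measure snd") auto

declare plrs.simps [simp del]

text \<open>
  In \<open>cut\<close>, the list \<open>take s cs\<close> holds the \<open>s\<close> entries that agree with the coefficients, so the
  position called \<open>s\<close> in the usual definition, with \<open>1 \<le> s \<le> L\<close>, is \<open>s + 1\<close> here.
\<close>

inductive legal :: "nat list \<Rightarrow> nat list \<Rightarrow> bool" for cs :: "nat list" where
  initial: "legal cs as"
    if "as \<noteq> []" "hd as > 0" "length as < length cs" "as = take (length as) cs"
| cut: "legal cs as"
    if "as = take s cs @ [t] @ replicate l 0 @ bs" "hd as > 0"
       "s < length cs" "t < cs ! s" "bs = [] \<or> legal cs bs"

definition decomp_value :: "nat list \<Rightarrow> nat list \<Rightarrow> nat" where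
  "decomp_value cs as = (\<Sum>i = 1..length as. as ! (i - 1) * plrs cs (length as + 1 - i))"

text \<open>Well defined for \<open>M \<ge> 1\<close> by the generalized Zeckendorf theorem.\<close>

definition legal_decomp :: "nat list \<Rightarrow> nat \<Rightarrow> nat list" where
  "legal_decomp cs M = (THE as. legal cs as \<and> decomp_value cs as = M)"

text \<open>The indices \<open>i\<^sub>1 \<ge> i\<^sub>2 \<ge> \<dots> \<ge> i\<^sub>k\<close> of the summands, repeated according to the coefficients.\<close>

definition summand_indices :: "nat list \<Rightarrow> nat list" where
  "summand_indices as =
     concat (map (\<lambda>i. replicate (as ! (i - 1)) (length as + 1 - i)) [1..<length as + 1])"

definition gaps :: "nat list \<Rightarrow> nat \<Rightarrow> nat list" where
  "gaps cs M = (let js = summand_indices (legal_decomp cs M) in map2 (-) js (tl js))"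

definition gap_count :: "nat list \<Rightarrow> nat \<Rightarrow> nat \<Rightarrow> nat" where
  "gap_count cs g M = count_list (gaps cs M) g"

definition plrs_interval :: "nat list \<Rightarrow> nat \<Rightarrow> nat set" where
  "plrs_interval cs n = {plrs cs n..<plrs cs (n + 1)}"

text \<open>
  \<open>K\<^bsub>g,n\<^esub>\<close> is \<open>gap_count cs g\<close> on the uniform distribution over \<open>[G\<^sub>n, G\<^bsub>n+1\<^esub>)\<close>. Being non-trivial
  is stated on the interval itself, so that it fails when the interval is empty, which happens
  for \<open>L = c\<^sub>1 = 1\<close>.
\<close>

definition gap_nontrivial :: "nat list \<Rightarrow> nat \<Rightarrow> nat \<Rightarrow> bool" where
  "gap_nontrivial cs g n \<longleftrightarrow> \<not> (\<forall>M \<in> plrs_interval cs n. gap_count cs g M = 0)"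

definition gap_variance :: "nat list \<Rightarrow> nat \<Rightarrow> nat \<Rightarrow> real" where
  "gap_variance cs g n =
     measure_pmf.variance (pmf_of_set (plrs_interval cs n)) (\<lambda>M. real (gap_count cs g M))"

end

theory Submission
  imports Defs "HOL-Complex_Analysis.Complex_Analysis"
begin

text \<open>
  Cut a legal word into maximal pieces \<open>c\<^sub>1, \<dots>, c\<^sub>s, t, 0, \<dots>, 0\<close> with \<open>t < c\<^bsub>s+1\<^esub>\<close>. All coefficients
  being positive, the pieces can be concatenated freely, and the number of gaps equal to \<open>g\<close> is
  additive over them, up to a boundary effect at the last piece. So the gap count is a renewal-reward
  process, whose moment generating functions have the form \<open>T / (1 - Q)\<close> where \<open>Q\<close> enumerates the
  pieces. After rescaling \<open>x\<close> so that \<open>Q(1) = 1\<close>, the factor \<open>1 - Q\<close> has a simple zero at 1 and no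
  other zero in a disc of radius greater than 1, because pieces of two consecutive lengths exist.

  Replacing the gap count \<open>K\<close> by \<open>K - \<mu> n\<close> does not change the variance. For the \<open>\<mu>\<close> that makes
  the mean weight of a piece vanish, the first moment generating function has only a simple pole at 1
  and the second one a double pole, so that the variance is linear up to an exponentially small
  error, with slope proportional to the second moment of the centered weight of a piece. If that
  moment vanished, every piece would have weight exactly \<open>\<mu>\<close> times its length; appending zeros does
  not change the number of gaps in the long run, so \<open>\<mu> = 0\<close> and then no gap \<open>g\<close> ever occurs.
\<close>

section \<open>Exponentially small sequences\<close>

text \<open>The rate \<open>\<gamma>\<close> is hidden behind a quantifier, so it may worsen from
  step to step without being tracked.\<close>

definition exp_small :: "(nat \<Rightarrow> real) \<Rightarrow> bool" where
  "exp_small f \<longleftrightarrow> (\<exists>\<gamma>. 0 < \<gamma> \<and> \<gamma> < 1 \<and> f \<in> O(\<lambda>n. \<gamma> ^ n))"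

text \<open>Cauchy-Hadamard in qualitative form: closure properties of exponentially small sequences
  become bounds on radii of convergence.\<close>

lemma exp_small_iff_fps_conv_radius:
  "exp_small (fps_nth F) \<longleftrightarrow> fps_conv_radius F > 1"
proof
  assume "exp_small (fps_nth F)"
  then obtain \<gamma> where \<gamma>: "0 < \<gamma>" "\<gamma> < 1" "fps_nth F \<in> O(\<lambda>n. \<gamma> ^ n)"
    by (auto simp: exp_small_def)
  \<comment> \<open>The midpoint of 1 and \<open>1 / \<gamma>\<close>, so that \<open>K > 1\<close>
    while \<open>\<gamma> * K < 1\<close> still holds.\<close>
  define K where "K = (1 + 1 / \<gamma>) / 2"
  have K: "K > 1" "\<gamma> * K < 1" using \<gamma> by (auto simp: K_def field_simps)
  have "(\<lambda>n. fps_nth F n * K ^ n) \<in> O(\<lambda>n. \<gamma> ^ n * K ^ n)"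
    by (intro landau_o.big.mult \<gamma>) auto
  also have "(\<lambda>n. \<gamma> ^ n * K ^ n) = (\<lambda>n. (\<gamma> * K) ^ n)" by (simp add: power_mult_distrib)
  finally have "summable (\<lambda>n. fps_nth F n * K ^ n)"
    using K \<gamma> by (elim summable_comparison_test_bigo[rotated]) (auto simp: norm_mult)
  then have "fps_conv_radius F \<ge> ereal (norm K)"
    unfolding fps_conv_radius_def by (rule conv_radius_geI)
  moreover have "ereal (norm K) > 1" using K by simp
  ultimately show "fps_conv_radius F > 1" by order
next
  assume "fps_conv_radius F > 1"
  then obtain K :: real where K: "1 < ereal K" "ereal K < fps_conv_radius F"
    using ereal_dense2 by blast
  then have K1: "K > 1" by simp
  have "summable (\<lambda>n. fps_nth F n * K ^ n)" by (rule summable_fps) (use K K1 in auto)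
  then have "(\<lambda>n. fps_nth F n * K ^ n) \<in> O(\<lambda>_. 1)"
    by (intro bigoI_tendsto[where c = 0]) (auto dest: summable_LIMSEQ_zero)
  then have "(\<lambda>n. fps_nth F n * K ^ n * (1 / K) ^ n) \<in> O(\<lambda>n. 1 * (1 / K) ^ n)"
    by (intro landau_o.big.mult) auto
  also have "(\<lambda>n. fps_nth F n * K ^ n * (1 / K) ^ n) = fps_nth F"
    using K1 by (auto simp: power_divide)
  finally show "exp_small (fps_nth F)" unfolding exp_small_def
    using K1 by (intro exI[of _ "1 / K"]) auto
qed

lemma exp_small_iff_Abs_fps: "exp_small f \<longleftrightarrow> fps_conv_radius (Abs_fps f) > 1"
proof -
  have "fps_nth (Abs_fps f) = f" by auto
  then show ?thesis using exp_small_iff_fps_conv_radius[of "Abs_fps f"] by simp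
qed

lemma fps_conv_radius_gt_add:
  "r < fps_conv_radius F \<Longrightarrow> r < fps_conv_radius G \<Longrightarrow> r < fps_conv_radius (F + G)"
  by (rule less_le_trans[OF _ fps_conv_radius_add]) auto

lemma fps_conv_radius_gt_diff:
  "r < fps_conv_radius F \<Longrightarrow> r < fps_conv_radius G \<Longrightarrow> r < fps_conv_radius (F - G)"
  by (rule less_le_trans[OF _ fps_conv_radius_diff]) auto

lemma fps_conv_radius_gt_mult:
  "r < fps_conv_radius F \<Longrightarrow> r < fps_conv_radius G \<Longrightarrow> r < fps_conv_radius (F * G)"
  by (rule less_le_trans[OF _ fps_conv_radius_mult]) auto

lemmas fps_conv_radius_gt = fps_conv_radius_gt_add fps_conv_radius_gt_diff fps_conv_radius_gt_mult

lemma exp_small_add: "exp_small f \<Longrightarrow> exp_small h \<Longrightarrow> exp_small (\<lambda>n. f n + h n)"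
  using fps_conv_radius_gt_add[of 1 "Abs_fps f" "Abs_fps h"]
  by (simp add: exp_small_iff_Abs_fps fps_plus_def)

text \<open>Multiplying coefficients by \<open>n\<close> is the operator X d/dX, and differentiation
  does not shrink the radius.\<close>

lemma exp_small_mult_nat: "exp_small f \<Longrightarrow> exp_small (\<lambda>n. real n * f n)"
proof -
  assume "exp_small f"
  then have "1 < fps_conv_radius (Abs_fps f)" by (simp add: exp_small_iff_Abs_fps)
  also have "\<dots> \<le> fps_conv_radius (fps_deriv (Abs_fps f))" by (rule fps_conv_radius_deriv)
  finally have "1 < fps_conv_radius (fps_X * fps_deriv (Abs_fps f))"
    by (intro fps_conv_radius_gt) auto
  then have "exp_small (fps_nth (fps_X * fps_deriv (Abs_fps f)))"
    by (simp add: exp_small_iff_fps_conv_radius)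
  also have "fps_nth (fps_X * fps_deriv (Abs_fps f)) = (\<lambda>n. real n * f n)" by auto
  finally show ?thesis .
qed

lemma exp_small_bounded_mult:
  assumes "exp_small f" "h \<in> O(\<lambda>_. 1)"
  shows "exp_small (\<lambda>n. f n * h n)"
proof -
  obtain \<gamma> where \<gamma>: "0 < \<gamma>" "\<gamma> < 1" "f \<in> O(\<lambda>n. \<gamma> ^ n)" using assms by (auto simp: exp_small_def)
  have "(\<lambda>n. f n * h n) \<in> O(\<lambda>n. \<gamma> ^ n * 1)" using \<gamma> assms by (intro landau_o.big.mult) auto
  then show ?thesis using \<gamma> by (auto simp: exp_small_def)
qed

lemma exp_small_const_mult: "exp_small f \<Longrightarrow> exp_small (\<lambda>n. c * f n)"
  using exp_small_bounded_mult[of f "\<lambda>_. c"] by (simp add: mult.commute)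

lemma exp_small_bigo_one: "exp_small f \<Longrightarrow> f \<in> O(\<lambda>_. 1)"
proof -
  assume "exp_small f"
  then obtain \<gamma> where \<gamma>: "0 < \<gamma>" "\<gamma> < 1" "f \<in> O(\<lambda>n. \<gamma> ^ n)" by (auto simp: exp_small_def)
  have "(\<lambda>n. \<gamma> ^ n) \<in> O(\<lambda>_. 1)"
    using \<gamma> by (intro bigoI_tendsto[where c = 0]) (auto intro: LIMSEQ_power_zero)
  with \<gamma> show ?thesis using landau_o.big_trans by blast
qed

lemma exp_small_mult: "exp_small f \<Longrightarrow> exp_small h \<Longrightarrow> exp_small (\<lambda>n. f n * h n)"
  by (intro exp_small_bounded_mult exp_small_bigo_one)

lemma exp_small_summable: "exp_small f \<Longrightarrow> summable f"
proof -
  assume "exp_small f"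
  then obtain \<gamma> where \<gamma>: "0 < \<gamma>" "\<gamma> < 1" "f \<in> O(\<lambda>n. \<gamma> ^ n)" by (auto simp: exp_small_def)
  then show ?thesis by (intro summable_comparison_test_bigo[OF _ \<gamma>(3)]) auto
qed

lemma exp_small_tendsto: "exp_small f \<Longrightarrow> f \<longlonglongrightarrow> 0"
  by (intro summable_LIMSEQ_zero exp_small_summable)

lemma exp_small_mono:
  assumes "exp_small h" "\<And>n. \<bar>f n\<bar> \<le> h n"
  shows "exp_small f"
proof -
  obtain \<gamma> where \<gamma>: "0 < \<gamma>" "\<gamma> < 1" "h \<in> O(\<lambda>n. \<gamma> ^ n)" using assms(1) by (auto simp: exp_small_def)
  have "\<bar>f n\<bar> \<le> \<bar>h n\<bar>" for n using assms(2)[of n] by linarith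
  then have "f \<in> O(h)" by (intro bigoI[of _ 1]) auto
  then show ?thesis using \<gamma> landau_o.big_trans unfolding exp_small_def by blast
qed

lemma exp_small_quadratic_growth:
  assumes "0 < \<rho>" "\<rho> < 1" "\<And>n. \<bar>f n\<bar> \<le> c * (real n + 1)\<^sup>2"
  shows "exp_small (\<lambda>n. f n * \<rho> ^ n)"
proof (rule exp_small_mono)
  have \<rho>: "exp_small (\<lambda>n. \<rho> ^ n)" using assms by (auto simp: exp_small_def intro!: exI[of _ \<rho>])
  have "exp_small (\<lambda>n. c * (real n * (real n * \<rho> ^ n) + 2 * (real n * \<rho> ^ n) + \<rho> ^ n))"
    by (intro exp_small_const_mult exp_small_add exp_small_mult_nat \<rho>)
  also have "(\<lambda>n. c * (real n * (real n * \<rho> ^ n) + 2 * (real n * \<rho> ^ n) + \<rho> ^ n)) =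
      (\<lambda>n. c * (real n + 1)\<^sup>2 * \<rho> ^ n)"
    by (intro ext) (simp add: power2_eq_square algebra_simps)
  finally show "exp_small (\<lambda>n. c * (real n + 1)\<^sup>2 * \<rho> ^ n)" .
  show "\<bar>f n * \<rho> ^ n\<bar> \<le> c * (real n + 1)\<^sup>2 * \<rho> ^ n" for n
    using assms by (simp add: abs_mult mult_right_mono)
qed

section \<open>Power series of renewal type\<close>

lemma eval_fps_one: "eval_fps F 1 = (\<Sum>n. fps_nth F n)"
  by (simp add: eval_fps_def)

lemma exp_small_tail:
  assumes "exp_small f"
  shows "exp_small (\<lambda>n. \<Sum>j. f (j + Suc n))"
proof -
  obtain \<gamma> where \<gamma>: "0 < \<gamma>" "\<gamma> < 1" "f \<in> O(\<lambda>n. \<gamma> ^ n)" using assms by (auto simp: exp_small_def)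
  then obtain c where c: "eventually (\<lambda>n. norm (f n) \<le> c * norm (\<gamma> ^ n)) at_top" "c > 0"
    by (elim landau_o.bigE)
  then obtain N where N: "\<And>n. n \<ge> N \<Longrightarrow> \<bar>f n\<bar> \<le> c * \<gamma> ^ n" using \<gamma>
    by (auto simp: eventually_at_top_linorder)
  have "(\<lambda>n. \<Sum>j. f (j + Suc n)) \<in> O(\<lambda>n. \<gamma> ^ n)"
  proof (rule bigoI[where c = "c * (\<gamma> / (1 - \<gamma>))"], rule eventually_sequentiallyI[of N])
    fix n assume n: "N \<le> n"
    have s: "(\<lambda>j. c * \<gamma> ^ (j + Suc n)) sums (c * (\<gamma> / (1 - \<gamma>)) * \<gamma> ^ n)"
      using sums_mult[OF geometric_sums[of \<gamma>], of "c * \<gamma> ^ Suc n"] \<gamma>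
      by (simp add: power_add mult_ac)
    have "norm (\<Sum>j. f (j + Suc n)) \<le> (\<Sum>j. c * \<gamma> ^ (j + Suc n))"
      by (rule norm_suminf_le) (use N[of "_ + Suc n"] n s in \<open>auto simp: sums_iff\<close>)
    also have "\<dots> = c * (\<gamma> / (1 - \<gamma>)) * \<gamma> ^ n" using s by (simp add: sums_iff)
    finally show "norm (\<Sum>j. f (j + Suc n)) \<le> c * (\<gamma> / (1 - \<gamma>)) * norm (\<gamma> ^ n)" using \<gamma> by simp
  qed
  with \<gamma> show ?thesis by (auto simp: exp_small_def)
qed

text \<open>\<open>F\<close> minus its value at 1 vanishes at 1, hence is divisible by
  \<open>1 - fps_X\<close>. The coefficients of the quotient are the partial sums of
  \<open>F\<close> minus the full sum, that is, negated tails.\<close>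

lemma fps_divide_one_minus_X:
  fixes F :: "real fps"
  assumes "fps_conv_radius F > 1"
  defines "G \<equiv> Abs_fps (\<lambda>n. - (\<Sum>j. fps_nth F (j + Suc n)))"
  shows "fps_conv_radius G > 1" "F = fps_const (eval_fps F 1) + (1 - fps_X) * G"
proof -
  have s: "summable (fps_nth F)" using summable_fps[of 1 F] assms by (simp add: one_ereal_def)
  have "exp_small (fps_nth F)" using assms by (simp add: exp_small_iff_fps_conv_radius)
  from exp_small_const_mult[OF exp_small_tail[OF this], of "- 1"]
  show "fps_conv_radius G > 1" by (simp add: G_def flip: exp_small_iff_Abs_fps)
  show "F = fps_const (eval_fps F 1) + (1 - fps_X) * G"
  proof (rule fps_ext)
    fix n
    show "fps_nth F n = fps_nth (fps_const (eval_fps F 1) + (1 - fps_X) * G) n"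
    proof (cases n)
      case 0
      then show ?thesis using suminf_split_head[OF s]
        by (simp add: G_def eval_fps_one algebra_simps)
    next
      case (Suc k)
      have "summable (\<lambda>j. fps_nth F (j + Suc k))" using s by (subst summable_iff_shift)
      from suminf_split_head[OF this] Suc show ?thesis
        by (simp add: G_def algebra_simps)
    qed
  qed
qed

lemma fps_divide_one_minus_X_ex:
  fixes F :: "real fps"
  assumes "fps_conv_radius F > 1"
  obtains G where "fps_conv_radius G > 1" "F = fps_const (eval_fps F 1) + (1 - fps_X) * G"
  using fps_divide_one_minus_X[OF assms] by blast

lemma one_minus_X_cancel: "(1 - fps_X) * F = (1 - fps_X) * (G :: real fps) \<Longrightarrow> F = G"
proof -
  have "fps_nth (1 - fps_X :: real fps) 0 \<noteq> 0" by simp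
  then have "1 - fps_X \<noteq> (0 :: real fps)" by (metis fps_zero_nth)
  then show "(1 - fps_X) * F = (1 - fps_X) * (G :: real fps) \<Longrightarrow> F = G" by simp
qed

section \<open>Coefficient asymptotics at simple and double poles\<close>

lemma fps_simple_pole_asymptotics:
  fixes F A :: "real fps"
  assumes "fps_conv_radius A > 1" "(1 - fps_X) * F = A"
  shows "exp_small (\<lambda>n. fps_nth F n - eval_fps A 1)"
proof -
  obtain G where G: "fps_conv_radius G > 1" "A = fps_const (eval_fps A 1) + (1 - fps_X) * G"
    using fps_divide_one_minus_X_ex assms by blast
  define H where "H = Abs_fps (\<lambda>n. eval_fps A 1) + G"
  have "(1 - fps_X) * Abs_fps (\<lambda>n. eval_fps A 1) = fps_const (eval_fps A 1)"
    by (rule fps_ext) (auto simp: algebra_simps)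
  then have "(1 - fps_X) * H = A" using G(2) by (simp add: H_def distrib_left)
  then have "F = H" using assms(2) one_minus_X_cancel by metis
  then show ?thesis using G(1) by (simp add: H_def exp_small_iff_fps_conv_radius)
qed

text \<open>Only the value z of \<open>Z\<close> at 1 sees the double pole: z / (1 - X)^2 has
  coefficients z (n + 1), and subtracting it leaves a simple pole.\<close>

lemma fps_double_pole_asymptotics:
  fixes F D Z :: "real fps"
  assumes "fps_conv_radius D > 1" "fps_conv_radius Z > 1"
    and "(1 - fps_X) * ((1 - fps_X) * F) = (1 - fps_X) * D + Z"
  obtains \<beta> where "exp_small (\<lambda>n. fps_nth F n - (eval_fps Z 1 * real n + \<beta>))"
proof -
  define z where "z = eval_fps Z 1"
  obtain Y where Y: "fps_conv_radius Y > 1" "Z = fps_const z + (1 - fps_X) * Y"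
    using fps_divide_one_minus_X_ex[OF assms(2)] unfolding z_def by blast
  define P where "P = Abs_fps (\<lambda>n. z * (real n + 1))"
  have P: "(1 - fps_X) * ((1 - fps_X) * P) = fps_const z"
  proof (rule fps_ext)
    fix n show "fps_nth ((1 - fps_X) * ((1 - fps_X) * P)) n = fps_nth (fps_const z) n"
      by (cases n rule: nat.exhaust[case_product nat.exhaust[of "n - 1"]])
         (auto simp: P_def algebra_simps)
  qed
  have "(1 - fps_X) * ((1 - fps_X) * (F - P)) = (1 - fps_X) * (D + Y)"
    unfolding right_diff_distrib[of "1 - fps_X"] P assms(3)
    by (subst Y(2)) (simp add: algebra_simps)
  then have "(1 - fps_X) * (F - P) = D + Y" by (rule one_minus_X_cancel)
  with fps_simple_pole_asymptotics[of "D + Y" "F - P"]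
  have "exp_small (\<lambda>n. fps_nth (F - P) n - eval_fps (D + Y) 1)"
    using Y assms by (auto intro: fps_conv_radius_gt)
  then have "exp_small (\<lambda>n. fps_nth F n - (z * real n + (z + eval_fps (D + Y) 1)))"
    by (simp add: P_def algebra_simps)
  then show ?thesis using that z_def by blast
qed

section \<open>Zeros of the renewal denominator in the complex disc\<close>

definition complexify :: "real fps \<Rightarrow> complex fps" where
  "complexify F = Abs_fps (\<lambda>n. complex_of_real (fps_nth F n))"

lemma fps_conv_radius_complexify: "fps_conv_radius (complexify F) = fps_conv_radius F"
  by (simp add: fps_conv_radius_def conv_radius_def complexify_def)

lemma complexify_mult: "complexify (F * G) = complexify F * complexify G"
  by (rule fps_ext) (simp add: complexify_def fps_mult_nth)

text \<open>The zeros of \<open>r\<close> in a slightly larger closed disc form a compact set. If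
  there are any, one has least modulus, which exceeds 1, and the inverse converges up to
  there.\<close>

lemma fps_conv_radius_inverse_gt_one:
  fixes r :: "real fps"
  assumes "fps_conv_radius r > 1" "fps_nth r 0 \<noteq> 0"
    and nz: "\<And>z. norm z \<le> 1 \<Longrightarrow> eval_fps (complexify r) z \<noteq> 0"
  shows "fps_conv_radius (inverse r) > 1"
proof -
  have "complexify r * complexify (inverse r) = complexify (r * inverse r)"
    by (simp add: complexify_mult)
  also have "r * inverse r = 1" using assms(2) by (simp add: inverse_mult_eq_1')
  also have "complexify 1 = 1" by (rule fps_ext) (simp add: complexify_def)
  finally have inv: "complexify (inverse r) = inverse (complexify r)" by (metis fps_inverse_unique)
  obtain K :: real where K: "1 < ereal K" "ereal K < fps_conv_radius r"
    using ereal_dense2 assms(1) by blast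
  define Z where "Z = {z \<in> cball 0 K. eval_fps (complexify r) z = 0}"
  have cont: "continuous_on (cball 0 K) (eval_fps (complexify r))"
    by (rule continuous_on_subset[OF continuous_on_eval_fps])
       (use K fps_conv_radius_complexify in
          \<open>auto intro: le_less_trans[OF iffD2[OF ereal_less_eq(3)]]\<close>)
  have "compact Z"
  proof -
    have "closed Z" unfolding Z_def
      using continuous_closed_preimage_constant[OF cont] by simp
    moreover have "Z \<subseteq> cball 0 K" by (auto simp: Z_def)
    ultimately show ?thesis by (meson bounded_cball bounded_subset compact_eq_bounded_closed)
  qed
  have "\<exists>R. 1 < R \<and> R \<le> K \<and> (\<forall>z. norm z < R \<longrightarrow> eval_fps (complexify r) z \<noteq> 0)"
  proof (cases "Z = {}")
    case True
    then show ?thesis using K by (intro exI[of _ K]) (auto simp: Z_def)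
  next
    case False
    then obtain w where w: "w \<in> Z" "\<And>z. z \<in> Z \<Longrightarrow> norm w \<le> norm z"
      using continuous_attains_inf[OF \<open>compact Z\<close>, of norm] by (auto intro: continuous_intros)
    have "norm w > 1" using w(1) nz[of w] by (force simp: Z_def complexify_def)
    moreover have "norm w \<le> K" using w(1) by (simp add: Z_def)
    moreover have "eval_fps (complexify r) z \<noteq> 0" if "norm z < norm w" for z
      using that w(2)[of z] \<open>norm w \<le> K\<close> by (force simp: Z_def)
    ultimately show ?thesis by blast
  qed
  then obtain R where R: "1 < R" "R \<le> K" "\<And>z. norm z < R \<Longrightarrow> eval_fps (complexify r) z \<noteq> 0" by blast
  have "1 < min (ereal R) (fps_conv_radius (complexify r))"
    using R(1) assms(1) by (simp add: fps_conv_radius_complexify)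
  also have "\<dots> \<le> fps_conv_radius (inverse (complexify r))"
    by (rule fps_conv_radius_inverse) (use R assms in \<open>auto simp: complexify_def\<close>)
  finally show ?thesis by (simp add: fps_conv_radius_complexify flip: inv)
qed

text \<open>A convex combination of powers of z, with z in the closed unit disc, equals 1 only if
  every power of positive weight equals 1. Two consecutive such exponents force z = 1, where
  \<open>eval_fps r 1\<close> is nonzero by hypothesis.\<close>

lemma renewal_eval_nonzero:
  fixes Q r :: "real fps"
  assumes Q: "fps_conv_radius Q > 1" "\<And>n. fps_nth Q n \<ge> 0" "eval_fps Q 1 = 1"
    and pos: "fps_nth Q k > 0" "fps_nth Q (Suc k) > 0"
    and r: "fps_conv_radius r > 1" "1 - Q = (1 - fps_X) * r" "eval_fps r 1 \<noteq> 0"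
    and z: "norm z \<le> 1"
  shows "eval_fps (complexify r) z \<noteq> 0"
proof (cases "z = 1")
  case True
  have "(\<lambda>n. complex_of_real (fps_nth r n)) sums complex_of_real (eval_fps r 1)"
    using sums_of_real[OF sums_eval_fps[of 1 r]] r(1) by (simp add: one_ereal_def)
  then show ?thesis using r(3) True by (simp add: complexify_def eval_fps_def sums_iff)
next
  case False
  have lt: "ereal (norm z) < fps_conv_radius F" if "fps_conv_radius F > 1" for F :: "complex fps"
    using z that by (metis ereal_less_eq(3) one_ereal_def order_le_less_trans)
  have "complexify (1 - Q) = 1 - complexify Q" "complexify (1 - fps_X) = 1 - fps_X"
    by (rule fps_ext, simp add: complexify_def fps_one_nth fps_X_def)+
  then have "1 - complexify Q = (1 - fps_X) * complexify r" by (simp only: r(2) complexify_mult)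
  then have "eval_fps (1 - complexify Q) z = eval_fps ((1 - fps_X) * complexify r) z" by simp
  then have "1 - eval_fps (complexify Q) z = (1 - z) * eval_fps (complexify r) z"
    using eval_fps_diff[OF lt lt, of 1 "complexify Q"] eval_fps_diff[OF lt lt, of 1 fps_X]
      eval_fps_mult[OF lt lt, of "1 - fps_X" "complexify r"] r(1) Q(1)
      fps_conv_radius_gt_diff[of 1 1 "fps_X :: complex fps"]
    by (simp add: fps_conv_radius_complexify)
  moreover have "eval_fps (complexify Q) z \<noteq> 1"
  proof
    assume eq: "eval_fps (complexify Q) z = 1"
    have "(\<lambda>n. complex_of_real (fps_nth Q n) * z ^ n) sums 1"
      using sums_eval_fps[of z "complexify Q"] lt[of "complexify Q"] Q(1) eq
      by (simp add: fps_conv_radius_complexify) (simp add: complexify_def)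
    from sums_Re[OF this] have "(\<lambda>n. fps_nth Q n * Re (z ^ n)) sums 1" by simp
    moreover have "fps_nth Q sums 1"
      using sums_eval_fps[of 1 Q] Q by (simp add: one_ereal_def)
    ultimately have s0: "(\<lambda>n. fps_nth Q n - fps_nth Q n * Re (z ^ n)) sums 0"
      using sums_diff by fastforce
    have le1: "Re (z ^ n) \<le> 1" for n
      using complex_Re_le_cmod[of "z ^ n"] z power_le_one[of "norm z" n] by (simp add: norm_power)
    have nn: "fps_nth Q n - fps_nth Q n * Re (z ^ n) \<ge> 0" for n
      using mult_left_mono[OF le1, of "fps_nth Q n" n] Q(2) by simp
    have "fps_nth Q n - fps_nth Q n * Re (z ^ n) = 0" for n
      using suminf_eq_zero_iff[of "\<lambda>n. fps_nth Q n - fps_nth Q n * Re (z ^ n)"] s0 nn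
      by (auto simp: sums_iff)
    then have Re1: "Re (z ^ n) = 1" if "fps_nth Q n > 0" for n
      using that by (metis diff_0_right eq_iff_diff_eq_0 less_irrefl mult_cancel_left1)
    have one: "z ^ n = 1" if "fps_nth Q n > 0" for n
    proof -
      have "norm (z ^ n) \<le> 1" using z by (simp add: norm_power power_le_one)
      then have "(Re (z ^ n))\<^sup>2 + (Im (z ^ n))\<^sup>2 \<le> 1"
        by (metis cmod_power2 norm_ge_zero one_power2 power_mono)
      then have "Im (z ^ n) = 0" using Re1[OF that] by simp
      then show ?thesis using Re1[OF that] by (simp add: complex_eq_iff)
    qed
    have "z ^ Suc k = z * z ^ k" by simp
    then show False using one[OF pos(1)] one[OF pos(2)] False by simp
  qed
  ultimately show ?thesis by (auto simp: complexify_def)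
qed

section \<open>From moments to the variance\<close>

lemma exp_small_inverse:
  assumes "exp_small (\<lambda>n. f n - a)" "a \<noteq> 0"
  shows "exp_small (\<lambda>n. 1 / f n - 1 / a)"
proof -
  have "(\<lambda>n. (f n - a) + a) \<longlonglongrightarrow> 0 + a"
    by (intro tendsto_add exp_small_tendsto[OF assms(1)] tendsto_const)
  then have f: "f \<longlonglongrightarrow> a" by simp
  then have "(\<lambda>n. - 1 / (f n * a)) \<longlonglongrightarrow> - 1 / (a * a)" using assms(2) by (intro tendsto_intros) auto
  then have "(\<lambda>n. - 1 / (f n * a)) \<in> O(\<lambda>_. 1)" by (intro bigoI_tendsto[where c = "- 1 / (a * a)"]) auto
  with assms(1) have "exp_small (\<lambda>n. (f n - a) * (- 1 / (f n * a)))" by (rule exp_small_bounded_mult)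
  then obtain \<gamma> where \<gamma>: "0 < \<gamma>" "\<gamma> < 1" "(\<lambda>n. (f n - a) * (- 1 / (f n * a))) \<in> O(\<lambda>n. \<gamma> ^ n)"
    by (auto simp: exp_small_def)
  \<comment> \<open>At finitely many \<open>n\<close> the value \<open>f n\<close> may be 0, where
    division yields 0 and the factorization can fail; equality is therefore only eventual.\<close>
  have "eventually (\<lambda>n. f n \<noteq> 0) at_top"
    using tendsto_imp_eventually_ne[OF f assms(2)] .
  then have "eventually (\<lambda>n. (f n - a) * (- 1 / (f n * a)) = 1 / f n - 1 / a) at_top"
    by eventually_elim (use assms(2) in \<open>simp add: field_simps\<close>)
  then have "(\<lambda>n. 1 / f n - 1 / a) \<in> O(\<lambda>n. \<gamma> ^ n)"
    using \<gamma>(3) landau_o.big.in_cong by force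
  with \<gamma> show ?thesis by (auto simp: exp_small_def)
qed

text \<open>An exponentially small error stays so after multiplication by \<open>real n\<close>, so
  the linear term survives division by \<open>n0\<close>.\<close>

lemma variance_asymptotics:
  fixes n0 n1 n2 :: "nat \<Rightarrow> real"
  assumes n0: "exp_small (\<lambda>n. n0 n - a)" and n1: "exp_small (\<lambda>n. n1 n - b)"
    and n2: "exp_small (\<lambda>n. n2 n - (\<alpha> * real n + \<beta>))" and "a \<noteq> 0"
  shows "exp_small (\<lambda>n. n2 n / n0 n - (n1 n / n0 n)\<^sup>2 - (\<alpha> / a * real n + (\<beta> / a - (b / a)\<^sup>2)))"
proof -
  define e0 where "e0 = (\<lambda>n. 1 / n0 n - 1 / a)"
  define e1 where "e1 = (\<lambda>n. n1 n - b)"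
  define e2 where "e2 = (\<lambda>n. n2 n - (\<alpha> * real n + \<beta>))"
  have e: "exp_small e0" "exp_small e1" "exp_small e2"
    using n1 n2 exp_small_inverse[OF n0 \<open>a \<noteq> 0\<close>] by (auto simp: e0_def e1_def e2_def)
  define d where "d = (\<lambda>n. b * e0 n + (1 / a) * e1 n + e1 n * e0 n)"
  have d: "exp_small d" unfolding d_def
    by (intro exp_small_add exp_small_const_mult exp_small_mult e)
  have "exp_small (\<lambda>n. \<alpha> * (real n * e0 n) + \<beta> * e0 n + (1 / a) * e2 n + e2 n * e0 n
          + (- 2 * (b / a)) * d n + (- 1) * (d n * d n))"
    by (intro exp_small_add exp_small_const_mult exp_small_mult exp_small_mult_nat e d)
  also have "(\<lambda>n. \<alpha> * (real n * e0 n) + \<beta> * e0 n + (1 / a) * e2 n + e2 n * e0 n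
          + (- 2 * (b / a)) * d n + (- 1) * (d n * d n)) =
      (\<lambda>n. n2 n / n0 n - (n1 n / n0 n)\<^sup>2 - (\<alpha> / a * real n + (\<beta> / a - (b / a)\<^sup>2)))"
  proof
    fix n
    have 0: "1 / n0 n = e0 n + 1 / a" by (simp add: e0_def)
    have 1: "n1 n / n0 n = b / a + d n"
      using 0 unfolding d_def e1_def divide_inverse by (simp add: algebra_simps)
    have 2: "n2 n / n0 n = (e2 n + \<alpha> * real n + \<beta>) * (e0 n + 1 / a)"
      using 0 unfolding e2_def divide_inverse by simp
    show "\<alpha> * (real n * e0 n) + \<beta> * e0 n + (1 / a) * e2 n + e2 n * e0 n
          + (- 2 * (b / a)) * d n + (- 1) * (d n * d n) =
      n2 n / n0 n - (n1 n / n0 n)\<^sup>2 - (\<alpha> / a * real n + (\<beta> / a - (b / a)\<^sup>2))"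
      unfolding 1 2 by (simp add: algebra_simps power2_eq_square)
  qed
  finally show ?thesis .
qed

text \<open>Indices are orders of moments, and the three equations are a renewal equation for
  additive weights, expanded binomially. The slope comes out as Q2(1) / r(1), where r = (1 - Q0) /
  (1 - X) and r(1) is the mean length under \<open>Q0\<close>.\<close>

lemma renewal_variance:
  fixes Q0 Q1 Q2 T0 T1 T2 N0 N1 N2 :: "real fps"
  assumes radius: "fps_conv_radius Q0 > 1" "fps_conv_radius Q1 > 1" "fps_conv_radius Q2 > 1"
      "fps_conv_radius T0 > 1" "fps_conv_radius T1 > 1" "fps_conv_radius T2 > 1"
    and N0: "N0 = T0 + Q0 * N0"
    and N1: "N1 = T1 + Q1 * N0 + Q0 * N1"
    and N2: "N2 = T2 + Q2 * N0 + 2 * Q1 * N1 + Q0 * N2"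
    and Q0: "\<And>n. fps_nth Q0 n \<ge> 0" "fps_nth Q0 0 = 0" "eval_fps Q0 1 = 1"
      "fps_nth Q0 k > 0" "fps_nth Q0 (Suc k) > 0"
    and Q1: "eval_fps Q1 1 = 0" and Q2: "eval_fps Q2 1 > 0" and T0: "eval_fps T0 1 > 0"
  shows "\<exists>C d. C > 0 \<and>
    exp_small (\<lambda>n. fps_nth N2 n / fps_nth N0 n - (fps_nth N1 n / fps_nth N0 n)\<^sup>2 - (C * real n + d))"
proof -
  have eval: "eval_fps (F + G) 1 = eval_fps F 1 + eval_fps G 1"
             "eval_fps (F * G) 1 = eval_fps F 1 * eval_fps G 1"
    if "fps_conv_radius F > 1" "fps_conv_radius G > 1" for F G :: "real fps"
    using that by (auto simp: eval_fps_add eval_fps_mult one_ereal_def)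
  \<comment> \<open>With \<open>Q0\<close> read as a distribution of lengths, coefficient
    \<open>n\<close> is the probability of exceeding \<open>n\<close>.\<close>
  define r where "r = Abs_fps (\<lambda>n. \<Sum>j. fps_nth Q0 (j + Suc n))"
  have s: "summable (fps_nth Q0)" using summable_fps[of 1 Q0] radius(1) by (simp add: one_ereal_def)
  have r_nth: "fps_nth r n \<ge> 0" for n
    using s Q0(1) unfolding r_def by (auto intro!: suminf_nonneg simp: summable_iff_shift simp del: add_Suc_right)
  have rE: "fps_conv_radius r > 1" "1 - Q0 = (1 - fps_X) * r"
  proof -
    have "Abs_fps (\<lambda>n. - (\<Sum>j. fps_nth Q0 (j + Suc n))) = - r" by (rule fps_ext) (simp add: r_def)
    with fps_divide_one_minus_X[OF radius(1)] Q0(3)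
    have "fps_conv_radius (- r) > 1" "Q0 = 1 + (1 - fps_X) * (- r)" by simp_all
    then show "fps_conv_radius r > 1" "1 - Q0 = (1 - fps_X) * r" by (simp_all add: algebra_simps)
  qed
  have r0: "fps_nth r 0 = 1"
    using arg_cong[OF rE(2), of "\<lambda>f. fps_nth f 0"] Q0(2) by simp
  have r1: "eval_fps r 1 > 0"
  proof -
    have "summable (fps_nth r)" using summable_fps[of 1 r] rE(1) by (simp add: one_ereal_def)
    then show ?thesis unfolding eval_fps_one
      by (rule suminf_pos2[of _ 0]) (use r_nth r0 in auto)
  qed
  define i where "i = inverse r"
  have i: "fps_conv_radius i > 1" unfolding i_def
    by (rule fps_conv_radius_inverse_gt_one[OF rE(1)])
       (use r0 r1 renewal_eval_nonzero[OF radius(1) Q0(1,3-5) rE] in auto)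
  have ir: "i * r = 1" using r0 by (simp add: i_def inverse_mult_eq_1)
  have i1: "eval_fps i 1 > 0"
  proof -
    have "eval_fps i 1 * eval_fps r 1 = 1" using eval(2)[OF i rE(1)] ir by simp
    then show ?thesis using r1 by (metis zero_less_mult_pos2 zero_less_one)
  qed
  \<comment> \<open>Solving a renewal equation divides by \<open>1 - Q0\<close>; as \<open>r\<close>
    has an inverse of radius above 1, this costs just one factor \<open>1 - fps_X\<close>.\<close>
  have pole: "(1 - fps_X) * N = i * T" if "N = T + Q0 * N" for N T
  proof -
    have "(1 - Q0) * N = T" using that by (simp add: algebra_simps)
    then have "i * ((1 - fps_X) * r * N) = i * T" by (simp add: rE(2))
    moreover have "i * ((1 - fps_X) * r * N) = (1 - fps_X) * N * (i * r)" by (simp add: algebra_simps)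
    ultimately show ?thesis using ir by simp
  qed
  \<comment> \<open>The zero of \<open>Q1\<close> at 1 cancels the pole of \<open>N0\<close> in
    \<open>Q1 * N0\<close>, and later that of \<open>N1\<close> in \<open>Q1 * N1\<close>.\<close>
  obtain P where P: "fps_conv_radius P > 1" "Q1 = (1 - fps_X) * P"
    using fps_divide_one_minus_X_ex[OF radius(2)] Q1 by auto
  define A where "A = i * T0"
  define B where "B = i * (T1 + P * A)"
  define D where "D = i * (T2 + 2 * P * B)"
  have AB: "fps_conv_radius A > 1" "fps_conv_radius B > 1" "fps_conv_radius D > 1"
    unfolding A_def B_def D_def using radius i P(1) by (auto intro!: fps_conv_radius_gt)
  have A: "(1 - fps_X) * N0 = A" using pole[OF N0] by (simp add: A_def)
  have B: "(1 - fps_X) * N1 = B"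
  proof -
    have "(1 - fps_X) * N1 = i * (T1 + P * ((1 - fps_X) * N0))"
      using pole[OF N1] by (simp add: P(2) mult_ac)
    then show ?thesis unfolding A B_def .
  qed
  have "(1 - fps_X) * N2 = i * (T2 + Q2 * N0 + 2 * P * B)"
  proof -
    have "(1 - fps_X) * N2 = i * (T2 + Q2 * N0 + 2 * P * ((1 - fps_X) * N1))"
      using pole[OF N2] by (simp add: P(2) mult_ac)
    then show ?thesis unfolding B .
  qed
  then have "(1 - fps_X) * N2 = D + i * Q2 * N0" by (simp add: D_def algebra_simps)
  \<comment> \<open>\<open>Q2\<close> does not vanish at 1, so the pole of \<open>N0\<close>
    persists and a second factor \<open>1 - fps_X\<close> has to be cleared.\<close>
  then have N2': "(1 - fps_X) * ((1 - fps_X) * N2) = (1 - fps_X) * D + i * Q2 * A"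
  proof -
    have "(1 - fps_X) * ((1 - fps_X) * N2) = (1 - fps_X) * D + i * Q2 * ((1 - fps_X) * N0)"
      by (simp only: \<open>(1 - fps_X) * N2 = D + i * Q2 * N0\<close>) (simp add: algebra_simps)
    then show ?thesis unfolding A .
  qed
  obtain \<beta> where "exp_small (\<lambda>n. fps_nth N2 n - (eval_fps (i * Q2 * A) 1 * real n + \<beta>))"
    using fps_double_pole_asymptotics[OF AB(3) _ N2'] i radius(3) AB(1) by (auto intro!: fps_conv_radius_gt)
  moreover have A1: "eval_fps A 1 > 0" using i1 T0 i radius(4) by (simp add: A_def eval)
  moreover have "eval_fps (i * Q2 * A) 1 / eval_fps A 1 > 0"
    using i1 Q2 A1 i radius(3) AB(1) by (simp add: eval fps_conv_radius_gt)
  ultimately show ?thesis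
    using variance_asymptotics[OF fps_simple_pole_asymptotics[OF AB(1) A]
        fps_simple_pole_asymptotics[OF AB(2) B], of "fps_nth N2" "eval_fps (i * Q2 * A) 1" \<beta>]
    by (intro exI[of _ "eval_fps (i * Q2 * A) 1 / eval_fps A 1"]
        exI[of _ "\<beta> / eval_fps A 1 - (eval_fps B 1 / eval_fps A 1)\<^sup>2"] conjI) auto
qed

text \<open>The generating function of \<open>f\<close> with its variable scaled by
  \<open>\<rho>\<close>, used to move the dominant pole to 1.\<close>

definition scaled_fps :: "real \<Rightarrow> (nat \<Rightarrow> real) \<Rightarrow> real fps" where
  "scaled_fps \<rho> f = Abs_fps (\<lambda>n. f n * \<rho> ^ n)"

lemma scaled_fps_nth [simp]: "fps_nth (scaled_fps \<rho> f) n = f n * \<rho> ^ n"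
  by (simp add: scaled_fps_def)

lemma scaled_fps_convolution:
  "scaled_fps \<rho> a * scaled_fps \<rho> b = scaled_fps \<rho> (\<lambda>n. \<Sum>m\<le>n. a (n - m) * b m)"
proof (rule fps_ext)
  fix n
  have "fps_nth (scaled_fps \<rho> b * scaled_fps \<rho> a) n = (\<Sum>m\<le>n. a (n - m) * b m) * \<rho> ^ n"
    unfolding fps_mult_nth sum_distrib_right atLeast0AtMost
  proof (intro sum.cong refl)
    fix m assume "m \<in> {..n}"
    then have "\<rho> ^ n = \<rho> ^ m * \<rho> ^ (n - m)" by (simp flip: power_add)
    then show "fps_nth (scaled_fps \<rho> b) m * fps_nth (scaled_fps \<rho> a) (n - m) = a (n - m) * b m * \<rho> ^ n"
      by simp
  qed
  then show "fps_nth (scaled_fps \<rho> a * scaled_fps \<rho> b) n =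
      fps_nth (scaled_fps \<rho> (\<lambda>n. \<Sum>m\<le>n. a (n - m) * b m)) n"
    by (simp add: mult.commute)
qed

lemma sums_geometric_from:
  fixes \<rho> :: real
  assumes "0 < \<rho>" "\<rho> < 1"
  shows "(\<lambda>j. if k \<le> j then \<rho> ^ j else 0) sums (\<rho> ^ k / (1 - \<rho>))"
proof -
  have "(\<lambda>i. \<rho> ^ k * \<rho> ^ i) sums (\<rho> ^ k * (1 / (1 - \<rho>)))"
    using assms by (intro sums_mult geometric_sums) auto
  then show ?thesis
    using sums_iff_shift[of "\<lambda>j. if k \<le> j then \<rho> ^ j else 0" k "\<rho> ^ k / (1 - \<rho>)"]
    by (simp add: power_add mult.commute)
qed

section \<open>Generalized Zeckendorf theorem\<close>

text \<open>
  Acceptance by the automaton that reads digits from the left; its state is the suffix of \<open>cs\<close> that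
  remains to be matched, and a digit below the expected coefficient resets it.
\<close>

fun accepts :: "nat list \<Rightarrow> nat list \<Rightarrow> nat list \<Rightarrow> bool" where
  "accepts cs [] w \<longleftrightarrow> False"
| "accepts cs (d # ds) [] \<longleftrightarrow> True"
| "accepts cs (d # ds) (a # w) \<longleftrightarrow> a < d \<and> accepts cs cs w \<or> a = d \<and> accepts cs ds w"

text \<open>For nonempty \<open>cs\<close> with positive entries, the words of length
  \<open>n\<close> accepted from state \<open>ds\<close> represent each number below this bound
  exactly once, so it also counts them.\<close>

fun word_bound :: "nat list \<Rightarrow> nat list \<Rightarrow> nat \<Rightarrow> nat" where
  "word_bound cs [] n = 0"
| "word_bound cs (d # ds) 0 = 1"
| "word_bound cs (d # ds) (Suc n) = d * plrs cs (Suc n) + word_bound cs ds n"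

lemma decomp_value_Nil [simp]: "decomp_value cs [] = 0"
  by (simp add: decomp_value_def)

lemma decomp_value_Cons [simp]:
  "decomp_value cs (a # w) = a * plrs cs (Suc (length w)) + decomp_value cs w"
proof -
  have "decomp_value cs (a # w) =
      (\<Sum>i = Suc 0..Suc (length w). (a # w) ! (i - 1) * plrs cs (Suc (length w) + 1 - i))"
    by (simp add: decomp_value_def)
  also have "\<dots> = a * plrs cs (Suc (length w)) +
      (\<Sum>i = Suc (Suc 0)..Suc (length w). (a # w) ! (i - 1) * plrs cs (Suc (length w) + 1 - i))"
    by (subst sum.atLeast_Suc_atMost) auto
  also have "(\<Sum>i = Suc (Suc 0)..Suc (length w). (a # w) ! (i - 1) * plrs cs (Suc (length w) + 1 - i)) =
      (\<Sum>i = Suc 0..length w. (a # w) ! i * plrs cs (Suc (length w) - i))"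
    by (subst sum.atLeast_Suc_atMost_Suc_shift) simp
  also have "\<dots> = decomp_value cs w"
    unfolding decomp_value_def by (intro sum.cong) (auto simp: nth_Cons')
  finally show ?thesis .
qed

lemma word_bound_eq_sum:
  "word_bound cs ds n = (\<Sum>i = 1..min n (length ds). ds ! (i - 1) * plrs cs (Suc n - i)) +
     (if n < length ds then 1 else 0)"
proof (induction cs ds n rule: word_bound.induct)
  case (3 cs d ds n)
  have "(\<Sum>i = 1..min (Suc n) (length (d # ds)). (d # ds) ! (i - 1) * plrs cs (Suc (Suc n) - i)) =
      (\<Sum>i = Suc 0..Suc (min n (length ds)). (d # ds) ! (i - 1) * plrs cs (Suc (Suc n) - i))"
    by simp
  also have "\<dots> = d * plrs cs (Suc n) +
      (\<Sum>i = Suc (Suc 0)..Suc (min n (length ds)). (d # ds) ! (i - 1) * plrs cs (Suc (Suc n) - i))"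
    by (subst sum.atLeast_Suc_atMost) auto
  also have "(\<Sum>i = Suc (Suc 0)..Suc (min n (length ds)). (d # ds) ! (i - 1) * plrs cs (Suc (Suc n) - i)) =
      (\<Sum>i = Suc 0..min n (length ds). (d # ds) ! i * plrs cs (Suc n - i))"
    by (subst sum.atLeast_Suc_atMost_Suc_shift) simp
  also have "\<dots> = (\<Sum>i = 1..min n (length ds). ds ! (i - 1) * plrs cs (Suc n - i))"
    by (intro sum.cong) (auto simp: nth_Cons')
  finally show ?case using "3.IH" by simp
qed auto

text \<open>At \<open>ds = cs\<close> the sum is the recurrence itself, and the extra 1, present
  while \<open>n < length cs\<close>, is the one of the initial conditions.\<close>

lemma word_bound_self: "cs \<noteq> [] \<Longrightarrow> word_bound cs cs n = plrs cs (Suc n)"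
  unfolding word_bound_eq_sum plrs.simps[of cs "Suc n"]
  by (auto simp: min_def atLeastLessThanSuc_atLeastAtMost not_less_eq_eq)

section \<open>Values of accepted words\<close>

locale positive_plrs =
  fixes cs :: "nat list"
  assumes nonempty: "cs \<noteq> []" and positive: "\<And>i. i < length cs \<Longrightarrow> cs ! i > 0"
begin

lemma hd_pos: "hd cs > 0"
  using nonempty positive[of 0] by (simp add: hd_conv_nth)

lemma plrs_mono: "m \<le> n \<Longrightarrow> plrs cs m \<le> plrs cs n"
proof (rule lift_Suc_mono_le[of "plrs cs"])
  fix n show "plrs cs n \<le> plrs cs (Suc n)"
  proof (cases n)
    case 0
    then show ?thesis by (simp add: plrs.simps)
  next
    case (Suc k)
    obtain d ds where "cs = d # ds" "d > 0" using nonempty hd_pos by (cases cs) auto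
    then have "plrs cs n \<le> word_bound cs cs n" using Suc
      by (metis le_add1 le_trans mult_le_mono1 mult_1 Suc_leI One_nat_def word_bound.simps(3))
    then show ?thesis using word_bound_self[OF nonempty] by simp
  qed
qed

text \<open>After a digit below the expected one the rest is accepted from \<open>cs\<close>, so its
  value stays below one unit of the current place.\<close>

lemma accepts_value_less: "accepts cs ds w \<Longrightarrow> decomp_value cs w < word_bound cs ds (length w)"
proof (induction w arbitrary: ds)
  case Nil
  then show ?case by (cases ds) auto
next
  case (Cons a w)
  obtain d ds' where ds: "ds = d # ds'" using Cons.prems by (cases ds) auto
  consider "a < d" "accepts cs cs w" | "a = d" "accepts cs ds' w" using Cons.prems ds by auto
  then show ?case
  proof cases
    case 1
    have "decomp_value cs w < plrs cs (Suc (length w))"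
      using Cons.IH[OF 1(2)] word_bound_self[OF nonempty] by simp
    then have "decomp_value cs (a # w) < Suc a * plrs cs (Suc (length w))" by simp
    also have "\<dots> \<le> d * plrs cs (Suc (length w))" using 1 by (intro mult_le_mono1) simp
    finally show ?thesis using ds by simp
  next
    case 2
    then show ?thesis using Cons.IH[OF 2(2)] ds by simp
  qed
qed

lemma accepts_value_less_plrs: "accepts cs cs w \<Longrightarrow> decomp_value cs w < plrs cs (Suc (length w))"
  using accepts_value_less[of cs w] word_bound_self[OF nonempty] by simp

text \<open>At the first differing digit the larger word gains at least one unit of that place, more
  than the rest of the other word can make up.\<close>

lemma accepts_value_inj:
  assumes "accepts cs ds w" "accepts cs ds w'" "length w = length w'"
    "decomp_value cs w = decomp_value cs w'"
  shows "w = w'"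
  using assms(3,1,2,4)
proof (induction w w' arbitrary: ds rule: list_induct2)
  case (Cons a w a' w')
  have less: False if "accepts cs ds (b # v)" "accepts cs ds (b' # v')" "length v = length v'"
    "decomp_value cs (b # v) = decomp_value cs (b' # v')" "b < b'" for b v b' v'
  proof -
    \<comment> \<open>The digit \<open>b'\<close> is at most the expected coefficient and
      \<open>b < b'\<close>, so reading \<open>b\<close> resets the automaton.\<close>
    have "accepts cs cs v" using that by (cases ds) auto
    then have "decomp_value cs (b # v) < Suc b * plrs cs (Suc (length v))"
      using accepts_value_less_plrs[of v] by simp
    also have "\<dots> \<le> b' * plrs cs (Suc (length v))" using that by (intro mult_le_mono1) simp
    also have "\<dots> \<le> decomp_value cs (b' # v')" using that by simp
    finally show False using that by simp
  qed
  have "a = a'" using less[of a w a' w'] less[of a' w' a w] Cons.prems Cons.hyps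
    by (metis linorder_neqE_nat)
  moreover obtain d ds' where "ds = d # ds'" using Cons.prems by (cases ds) auto
  ultimately show ?case using Cons by auto
qed simp

text \<open>Greedy choice: the digit is the quotient of \<open>M\<close> by the current place value
  if that is below \<open>d\<close>, and \<open>d\<close> otherwise.\<close>

lemma accepts_value_surj:
  "M < word_bound cs ds n \<Longrightarrow> \<exists>w. length w = n \<and> accepts cs ds w \<and> decomp_value cs w = M"
proof (induction n arbitrary: ds M)
  case 0
  then show ?case by (cases ds) auto
next
  case (Suc n)
  obtain d ds' where ds: "ds = d # ds'" using Suc.prems by (cases ds) auto
  let ?G = "plrs cs (Suc n)"
  show ?case
  proof (cases "M < d * ?G")
    case True
    then have "?G > 0" by (cases ?G) auto
    then have "M mod ?G < word_bound cs cs n" using word_bound_self[OF nonempty] by simp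
    from Suc.IH[OF this] obtain w where
      w: "length w = n" "accepts cs cs w" "decomp_value cs w = M mod ?G" by blast
    have "M div ?G < d" using True \<open>?G > 0\<close> by (simp add: less_mult_imp_div_less)
    then show ?thesis using w ds by (intro exI[of _ "M div ?G # w"]) (simp add: div_mult_mod_eq)
  next
    case False
    then have "M - d * ?G < word_bound cs ds' n" using Suc.prems ds by simp
    from Suc.IH[OF this] obtain w where
      w: "length w = n" "accepts cs ds' w" "decomp_value cs w = M - d * ?G" by blast
    then show ?thesis using ds False by (intro exI[of _ "d # w"]) auto
  qed
qed

section \<open>Legal decompositions as accepted words\<close>

lemma accepts_common_prefix: "accepts cs (us @ ds) (us @ w) \<longleftrightarrow> accepts cs ds w"
  by (induction us) auto

text \<open>Since the first coefficient is positive, a leading 0 resets the automaton to its initial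
  state.\<close>

lemma accepts_zeros: "accepts cs cs (replicate l 0 @ w) \<longleftrightarrow> accepts cs cs w"
proof (induction l)
  case (Suc l)
  obtain d ds where "cs = d # ds" "d > 0" using nonempty hd_pos by (cases cs) auto
  then have "accepts cs cs (0 # v) \<longleftrightarrow> accepts cs cs v" for v by (metis accepts.simps(3) less_irrefl)
  then show ?case using Suc by simp
qed simp

lemma accepts_cases:
  assumes "accepts cs ds w"
  obtains "length w < length ds" "w = take (length w) ds"
  | s t v where "s < length ds" "t < ds ! s" "w = take s ds @ t # v" "accepts cs cs v"
  using assms
proof (induction w arbitrary: ds thesis)
  case Nil
  then show ?case by (cases ds) auto
next
  case (Cons a w)
  obtain d ds' where ds: "ds = d # ds'" using Cons.prems by (cases ds) auto
  consider "a < d" "accepts cs cs w" | "a = d" "accepts cs ds' w" using Cons.prems ds by auto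
  then show ?case
  proof cases
    case 1
    then show ?thesis using Cons.prems(2)[of 0 a w] ds by simp
  next
    case 2
    show ?thesis
    proof (rule Cons.IH[OF _ _ 2(2)])
      assume "length w < length ds'" "w = take (length w) ds'"
      then show ?thesis using Cons.prems(1) ds 2 by simp
    next
      fix s t v
      assume "s < length ds'" "t < ds' ! s" "w = take s ds' @ t # v" "accepts cs cs v"
      then show ?thesis using Cons.prems(2)[of "Suc s" t v] ds 2 by simp
    qed
  qed
qed

lemma accepts_cut:
  assumes "s < length cs" "t < cs ! s" "accepts cs cs v"
  shows "accepts cs cs (take s cs @ t # v)"
proof -
  have "accepts cs (cs ! s # drop (Suc s) cs) (t # v)" using assms by simp
  then have "accepts cs (take s cs @ cs ! s # drop (Suc s) cs) (take s cs @ t # v)"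
    by (simp only: accepts_common_prefix)
  then show ?thesis using assms(1) by (simp add: id_take_nth_drop[symmetric])
qed

lemma legal_imp_accepts: "legal cs w \<Longrightarrow> accepts cs cs w"
proof (induction rule: legal.induct)
  case (initial w)
  then have "accepts cs (drop (length w) cs) []"
    by (cases "drop (length w) cs") auto
  then have "accepts cs (take (length w) cs @ drop (length w) cs) (take (length w) cs @ [])"
    by (simp only: accepts_common_prefix)
  then have "accepts cs cs (take (length w) cs)" by simp
  then show ?case using initial by metis
next
  case (cut w s t l bs)
  have "accepts cs cs bs" using cut nonempty by (cases cs) auto
  then show ?case using accepts_cut[of s t "replicate l 0 @ bs"] cut by (simp add: accepts_zeros)
qed

lemma accepts_imp_legal: "accepts cs cs w \<Longrightarrow> w \<noteq> [] \<Longrightarrow> hd w > 0 \<Longrightarrow> legal cs w"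
proof (induction "length w" arbitrary: w rule: less_induct)
  case less
  from less.prems(1) show ?case
  proof (cases rule: accepts_cases)
    case 1
    then show ?thesis using less.prems legal.initial by blast
  next
    case (2 s t v)
    \<comment> \<open>The run of zeros is taken maximal, because the word left over must start with
      a positive digit to be legal.\<close>
    define l where "l = length (takeWhile (\<lambda>x. x = 0) v)"
    define bs where "bs = dropWhile (\<lambda>x. x = 0) v"
    have "takeWhile (\<lambda>x. x = 0) v = replicate l 0"
      unfolding l_def by (metis (mono_tags, lifting) replicate_eqI set_takeWhileD)
    then have v: "v = replicate l 0 @ bs" by (metis bs_def takeWhile_dropWhile_id)
    have "bs = [] \<or> legal cs bs"
    proof (cases "bs = []")
      case False
      then have "hd bs > 0" unfolding bs_def by (metis (mono_tags, lifting) hd_dropWhile neq0_conv)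
      moreover have "accepts cs cs bs" using 2(4) v accepts_zeros by simp
      ultimately show ?thesis using less.hyps[of bs] False v 2(3) by simp
    qed simp
    then show ?thesis using legal.cut[of w s cs t l bs] 2 v less.prems by simp
  qed
qed

lemma legal_hd: "legal cs w \<Longrightarrow> w \<noteq> [] \<and> hd w > 0"
  by (induction rule: legal.induct) auto

definition legal_words :: "nat \<Rightarrow> nat list set" where
  "legal_words n = {w. legal cs w \<and> length w = n}"

lemma legal_words_0 [simp]: "legal_words 0 = {}"
  using legal_hd by (auto simp: legal_words_def)

lemma legal_value_interval:
  assumes "legal cs w"
  shows "decomp_value cs w \<in> plrs_interval cs (length w)"
proof -
  obtain a v where w: "w = a # v" "a > 0" using legal_hd[OF assms] by (cases w) auto
  have "plrs cs (length w) \<le> a * plrs cs (length w)" using w(2) by simp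
  also have "\<dots> \<le> decomp_value cs w" by (simp add: w(1))
  finally show ?thesis using accepts_value_less_plrs[OF legal_imp_accepts[OF assms]]
    by (simp add: plrs_interval_def)
qed

text \<open>Accepted words of length \<open>n\<close> represent the numbers below
  \<open>plrs cs (n + 1)\<close>. A leading 0 keeps the value below \<open>plrs cs n\<close>, a
  positive leading digit brings it to at least that.\<close>

lemma bij_betw_decomp_value:
  assumes "n > 0"
  shows "bij_betw (decomp_value cs) (legal_words n) (plrs_interval cs n)"
proof (rule bij_betw_imageI)
  show "inj_on (decomp_value cs) (legal_words n)"
    by (auto intro!: inj_onI accepts_value_inj[of cs] simp: legal_words_def legal_imp_accepts)
  have "M \<in> decomp_value cs ` legal_words n" if M: "M \<in> plrs_interval cs n" for M
  proof -
    have "M < word_bound cs cs n" using M word_bound_self[OF nonempty] by (simp add: plrs_interval_def)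
    then obtain w where w: "length w = n" "accepts cs cs w" "decomp_value cs w = M"
      using accepts_value_surj by blast
    obtain a v where v: "w = a # v" using w(1) assms by (cases w) auto
    have "a > 0"
    proof (rule ccontr)
      assume "\<not> a > 0"
      then have "accepts cs cs v" using w(2) v accepts_zeros[of 1 v] by simp
      then have "M < plrs cs n" using accepts_value_less_plrs[of v] w v \<open>\<not> a > 0\<close> by auto
      then show False using M by (simp add: plrs_interval_def)
    qed
    then have "legal cs w" using accepts_imp_legal w v by simp
    then show ?thesis using w by (auto simp: legal_words_def)
  qed
  then show "decomp_value cs ` legal_words n = plrs_interval cs n"
    using legal_value_interval by (auto simp: legal_words_def)
qed

lemma finite_legal_words: "finite (legal_words n)"
  using bij_betw_finite[OF bij_betw_decomp_value, of n]
  by (cases "n = 0") (auto simp: plrs_interval_def)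

text \<open>By monotonicity of \<open>plrs\<close>, intervals for different lengths are disjoint, so
  the value determines the length and then the word.\<close>

lemma legal_decomp_decomp_value:
  assumes "legal cs w"
  shows "legal_decomp cs (decomp_value cs w) = w"
  unfolding legal_decomp_def
proof (rule the_equality)
  fix v assume v: "legal cs v \<and> decomp_value cs v = decomp_value cs w"
  have "plrs cs (length v) < plrs cs (Suc (length w))" "plrs cs (length w) < plrs cs (Suc (length v))"
    using legal_value_interval[OF assms] legal_value_interval[of v] v by (auto simp: plrs_interval_def)
  then have "length v = length w"
    using plrs_mono[of "Suc (length w)" "length v"] plrs_mono[of "Suc (length v)" "length w"]
    by (meson Suc_leI linorder_neqE_nat not_le)
  then show "v = w" using accepts_value_inj[of cs v w] v assms legal_imp_accepts by blast
qed (use assms in simp)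

end

section \<open>Gaps and the decomposition into blocks\<close>

definition diffs :: "nat list \<Rightarrow> nat list" where
  "diffs js = map2 (-) js (tl js)"

definition word_gap_count :: "nat \<Rightarrow> nat list \<Rightarrow> nat" where
  "word_gap_count g w = count_list (diffs (summand_indices w)) g"

lemma gap_count_eq: "gap_count cs g M = word_gap_count g (legal_decomp cs M)"
  by (simp add: gap_count_def gaps_def word_gap_count_def diffs_def Let_def)

lemma diffs_Nil [simp]: "diffs [] = []" and diffs_single [simp]: "diffs [i] = []"
  and diffs_Cons_Cons [simp]: "diffs (i # j # js) = (i - j) # diffs (j # js)"
  by (simp_all add: diffs_def)

lemma diffs_append:
  "us \<noteq> [] \<Longrightarrow> vs \<noteq> [] \<Longrightarrow> diffs (us @ vs) = diffs us @ (last us - hd vs) # diffs vs"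
proof (induction us)
  case (Cons u us)
  then show ?case by (cases us; cases vs) auto
qed simp

lemma diffs_shift: "diffs (map (\<lambda>j. j + k) js) = diffs js"
proof (induction js)
  case (Cons j js)
  then show ?case by (cases js) auto
qed simp

lemma length_diffs: "length (diffs js) = length js - 1"
  by (cases js) (auto simp: diffs_def)

lemma summand_indices_Nil [simp]: "summand_indices [] = []"
  by (simp add: summand_indices_def)

lemma summand_indices_Cons [simp]:
  "summand_indices (a # w) = replicate a (Suc (length w)) @ summand_indices w"
proof -
  have "[1..<length (a # w) + 1] = 1 # map Suc [1..<length w + 1]"
    by (simp add: upt_conv_Cons map_Suc_upt del: upt_Suc)
  then show ?thesis
    unfolding summand_indices_def
    by (auto simp: comp_def nth_Cons' simp del: upt_Suc intro!: arg_cong[of _ _ concat])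
qed

lemma summand_indices_append:
  "summand_indices (u @ w) = map (\<lambda>j. j + length w) (summand_indices u) @ summand_indices w"
  by (induction u) auto

lemma summand_indices_zeros [simp]: "summand_indices (replicate l 0) = []"
  by (induction l) auto

lemma length_summand_indices: "length (summand_indices w) = sum_list w"
  by (induction w) auto

lemma word_gap_count_append_zeros: "word_gap_count g (u @ replicate l 0) = word_gap_count g u"
  by (simp add: word_gap_count_def summand_indices_append diffs_shift)

text \<open>Joining shifts the indices of \<open>u\<close> by \<open>length w\<close>, which is also
  the first index of \<open>w\<close>. The new gap is thus the last index of \<open>u\<close> before
  the shift.\<close>

lemma word_gap_count_append:
  assumes "summand_indices u \<noteq> []" "w \<noteq> []" "hd w > 0"
  shows "word_gap_count g (u @ w) = word_gap_count g u +
    (if last (summand_indices u) = g then 1 else 0) + word_gap_count g w"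
proof -
  obtain a v where w: "w = a # v" "a > 0" using assms by (cases w) auto
  then have "summand_indices w \<noteq> []" "hd (summand_indices w) = length w" by (cases a; simp)+
  then show ?thesis using assms
    by (simp add: word_gap_count_def summand_indices_append diffs_append diffs_shift last_map)
qed

lemma word_gap_count_le: "word_gap_count g w \<le> sum_list w"
proof -
  have "word_gap_count g w \<le> length (diffs (summand_indices w))"
    unfolding word_gap_count_def by (rule count_le_length)
  then show ?thesis by (simp add: length_diffs length_summand_indices)
qed

context positive_plrs
begin

text \<open>
  A head \<open>(s, t)\<close> stands for the block \<open>c\<^sub>1, \<dots>, c\<^sub>s, t\<close>. Excluding \<open>(0, 0)\<close> makes
  the first digit of a block positive, so that cutting a legal word into blocks followed by
  runs of zeros is unique.
\<close>

definition heads :: "(nat \<times> nat) set" where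
  "heads = (SIGMA s:{..<length cs}. {..<cs ! s}) - {(0, 0)}"

definition block :: "nat \<times> nat \<Rightarrow> nat list" where
  "block h = take (fst h) cs @ [snd h]"

definition heads_le :: "nat \<Rightarrow> (nat \<times> nat) set" where
  "heads_le j = {h \<in> heads. Suc (fst h) \<le> j}"

text \<open>Here \<open>j\<close> is the total length, zeros included; the subtraction is exact for
  \<open>h \<in> heads_le j\<close>.\<close>

definition padded_block :: "nat \<times> nat \<Rightarrow> nat \<Rightarrow> nat list" where
  "padded_block h j = block h @ replicate (j - Suc (fst h)) 0"

lemma finite_heads: "finite heads"
  by (simp add: heads_def)

lemma finite_heads_le [simp]: "finite (heads_le j)"
  using finite_heads by (simp add: heads_le_def)

lemma headsD:
  assumes "h \<in> heads"
  shows "fst h < length cs" "snd h < cs ! fst h" "fst h > 0 \<or> snd h > 0"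
  using assms by (auto simp: heads_def)

lemma length_block: "h \<in> heads \<Longrightarrow> length (block h) = Suc (fst h)"
  by (auto simp: block_def dest: headsD)

lemma length_padded_block: "h \<in> heads_le j \<Longrightarrow> length (padded_block h j) = j"
  by (auto simp: padded_block_def heads_le_def length_block)

lemma hd_block: "h \<in> heads \<Longrightarrow> block h \<noteq> [] \<and> hd (block h) > 0"
  using headsD[of h] hd_pos nonempty by (cases "fst h") (auto simp: block_def hd_append)

lemma hd_padded_block: "h \<in> heads_le j \<Longrightarrow> padded_block h j \<noteq> [] \<and> hd (padded_block h j) > 0"
  using hd_block[of h] by (auto simp: padded_block_def heads_le_def)

lemma legal_padded_block_append:
  assumes "h \<in> heads_le j" "w = [] \<or> legal cs w"
  shows "legal cs (padded_block h j @ w)"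
proof (rule legal.cut)
  show "padded_block h j @ w = take (fst h) cs @ [snd h] @ replicate (j - Suc (fst h)) 0 @ w"
    by (simp add: padded_block_def block_def)
  show "0 < hd (padded_block h j @ w)" using hd_padded_block[OF assms(1)] by simp
qed (use assms headsD[of h] in \<open>auto simp: heads_le_def\<close>)

lemma legal_take: "0 < n \<Longrightarrow> n < length cs \<Longrightarrow> legal cs (take n cs)"
  using hd_pos by (intro legal.initial) (auto simp: min_def nonempty)

lemma legal_cases:
  assumes "legal cs w"
  obtains "0 < length w" "length w < length cs" "w = take (length w) cs"
  | h j v where "h \<in> heads_le j" "w = padded_block h j @ v" "v = [] \<or> legal cs v"
  using assms
proof cases
  case initial
  then show ?thesis using that(1) by auto
next
  case (cut s t l bs)
  \<comment> \<open>If \<open>s = 0\<close>, then \<open>t\<close> is the first digit and hence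
    positive.\<close>
  have "(s, t) \<in> heads" using cut by (cases s) (auto simp: heads_def)
  then show ?thesis
    using that(2)[of "(s, t)" "Suc s + l" bs] cut by (auto simp: heads_le_def padded_block_def block_def)
qed

lemma padded_block_append_nth:
  assumes "h \<in> heads_le j"
  shows "i < fst h \<Longrightarrow> (padded_block h j @ w) ! i = cs ! i"
    "(padded_block h j @ w) ! fst h = snd h"
  using assms headsD[of h] by (auto simp: padded_block_def block_def heads_le_def nth_append min_def)

lemma padded_block_append_neq_take:
  assumes "h \<in> heads_le j"
  shows "padded_block h j @ w \<noteq> take n cs"
proof
  assume eq: "padded_block h j @ w = take n cs"
  have "fst h < length (padded_block h j @ w)"
    using assms by (auto simp: length_padded_block) (auto simp: heads_le_def)
  then have "(padded_block h j @ w) ! fst h = cs ! fst h" using eq by simp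
  moreover have "(padded_block h j @ w) ! fst h < cs ! fst h"
    using padded_block_append_nth[OF assms] headsD[of h] assms by (simp add: heads_le_def)
  ultimately show False by simp
qed

text \<open>The head is read off at the first digit that departs from \<open>cs\<close>; the zeros
  then end at the first positive digit, or with the word.\<close>

lemma padded_block_append_inj:
  assumes "h \<in> heads_le j" "h' \<in> heads_le j'" "padded_block h j @ w = padded_block h' j' @ w'"
    and "w = [] \<or> hd w > 0" "w' = [] \<or> hd w' > 0"
  shows "h = h' \<and> j = j' \<and> w = w'"
proof -
  have nlt: "\<not> fst k < fst k'" if "k \<in> heads_le i" "k' \<in> heads_le i'"
    "padded_block k i @ v = padded_block k' i' @ v'" for k k' i i' v v'
    using padded_block_append_nth(2)[OF that(1), of v]
      padded_block_append_nth(1)[OF that(2), of "fst k" v']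
      that headsD[of k] by (auto simp: heads_le_def)
  have fst: "fst h = fst h'" using nlt[OF assms(1-3)] nlt[OF assms(2,1) assms(3)[symmetric]] by simp
  moreover have "snd h = snd h'"
    using padded_block_append_nth(2)[OF assms(1), of w]
      padded_block_append_nth(2)[OF assms(2), of w'] assms(3) fst
    by simp
  ultimately have h: "h = h'" by (simp add: prod_eq_iff)
  have dw: "dropWhile (\<lambda>x. x = 0) (replicate l 0 @ v) = v" if "v = [] \<or> hd v > 0" for l and v :: "nat list"
    using that by (induction l) (cases v, auto)
  have "replicate (j - Suc (fst h)) 0 @ w = replicate (j' - Suc (fst h)) 0 @ w'"
    using assms(3) h by (simp add: padded_block_def)
  then have w: "w = w'" using dw[OF assms(4)] dw[OF assms(5)] by metis
  moreover have "j = j'"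
    using arg_cong[OF assms(3), of length] w assms(1,2) by (simp add: length_padded_block)
  ultimately show ?thesis using h by simp
qed

section \<open>Splitting off the first block\<close>

definition prefix_words :: "nat \<Rightarrow> nat list set" where
  "prefix_words n = (if 0 < n \<and> n < length cs then {take n cs} else {})"

text \<open>The range of \<open>m\<close> includes 0 and \<open>n\<close> to match a Cauchy product;
  these terms are empty, as \<open>legal_words 0\<close> and \<open>heads_le 0\<close> are.\<close>

lemma legal_words_eq:
  "legal_words n = prefix_words n \<union> (\<lambda>h. padded_block h n) ` heads_le n \<union>
     (\<Union>m\<in>{..n}. (\<lambda>(h, w). padded_block h (n - m) @ w) ` (heads_le (n - m) \<times> legal_words m))"
  (is "_ = ?P \<union> ?B \<union> ?R")
proof (intro equalityI subsetI)
  fix w assume "w \<in> legal_words n"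
  then have w: "legal cs w" "length w = n" by (auto simp: legal_words_def)
  from w(1) show "w \<in> ?P \<union> ?B \<union> ?R"
  proof (cases rule: legal_cases)
    case 1
    then show ?thesis using w by (auto simp: prefix_words_def)
  next
    case (2 h j v)
    show ?thesis
    proof (cases "v = []")
      case True
      then have "j = n" using 2 w by (simp add: length_padded_block)
      then have "w \<in> ?B" using 2 True by auto
      then show ?thesis by blast
    next
      case False
      have "length v \<le> n" "j = n - length v" using 2 w by (auto simp: length_padded_block)
      moreover have "v \<in> legal_words (length v)" using 2 False by (simp add: legal_words_def)
      ultimately have "w \<in> ?R" using 2 by (intro UN_I[of "length v"]) auto
      then show ?thesis by blast
    qed
  qed
next
  fix w assume "w \<in> ?P \<union> ?B \<union> ?R"
  then consider "w \<in> ?P" | h where "h \<in> heads_le n" "w = padded_block h n"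
    | m h v where "m \<le> n" "h \<in> heads_le (n - m)" "v \<in> legal_words m" "w = padded_block h (n - m) @ v"
    by auto
  then show "w \<in> legal_words n"
  proof cases
    case 1
    then show ?thesis by (auto simp: prefix_words_def legal_words_def legal_take split: if_splits)
  next
    case (2 h)
    then show ?thesis using legal_padded_block_append[of h n "[]"]
      by (auto simp: legal_words_def length_padded_block)
  next
    case (3 m h v)
    then show ?thesis using legal_padded_block_append[of h "n - m" v]
      by (auto simp: legal_words_def length_padded_block)
  qed
qed

text \<open>Uniqueness of the splitting makes the three kinds of words disjoint and their
  parametrizations injective.\<close>

lemma sum_legal_words:
  fixes f :: "nat list \<Rightarrow> real"
  shows "(\<Sum>w\<in>legal_words n. f w) =
    (\<Sum>w\<in>prefix_words n. f w) + (\<Sum>h\<in>heads_le n. f (padded_block h n)) +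
    (\<Sum>m\<le>n. \<Sum>w\<in>legal_words m. \<Sum>h\<in>heads_le (n - m). f (padded_block h (n - m) @ w))"
proof -
  let ?P = "prefix_words n" and ?B = "(\<lambda>h. padded_block h n) ` heads_le n"
  let ?R = "\<lambda>m. (\<lambda>(h, w). padded_block h (n - m) @ w) ` (heads_le (n - m) \<times> legal_words m)"
  have pos: "w = [] \<or> hd w > 0" if "w \<in> legal_words m" for w m
    using legal_hd that by (auto simp: legal_words_def)
  have inj0: "h = h' \<and> j = j' \<and> w = []" if "h \<in> heads_le j" "h' \<in> heads_le j'"
    "padded_block h j = padded_block h' j' @ w" "w = [] \<or> hd w > 0" for h h' j j' w
    using padded_block_append_inj[of h j h' j' "[]" w] that by simp
  have fin: "finite ?P" "finite ?B" "\<And>m. finite (?R m)"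
    using finite_legal_words by (auto simp: prefix_words_def)
  have PB: "?P \<inter> ?B = {}"
  proof -
    have "padded_block h n \<noteq> take n cs" if "h \<in> heads_le n" for h
      using padded_block_append_neq_take[OF that, of "[]" n] by simp
    then have "take n cs \<notin> ?B" by (metis imageE)
    then show ?thesis by (simp add: prefix_words_def)
  qed
  have PR: "(?P \<union> ?B) \<inter> (\<Union>m\<in>{..n}. ?R m) = {}"
  proof -
    have "?P \<inter> ?R m = {}" for m
      using padded_block_append_neq_take by (fastforce simp: prefix_words_def split: if_splits)
    moreover have "?B \<inter> ?R m = {}" for m
    proof -
      have False if "h \<in> heads_le n" "h' \<in> heads_le (n - m)" "w \<in> legal_words m"
        "padded_block h n = padded_block h' (n - m) @ w" for h h' w
        using inj0[OF that(1,2,4) pos[OF that(3)]] that(3) legal_hd by (auto simp: legal_words_def)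
      then have "x \<notin> ?R m" if "x \<in> ?B" for x using that by (elim imageE) (auto, metis)
      then show ?thesis by (simp add: disjoint_iff)
    qed
    ultimately show ?thesis by blast
  qed
  have RR: "?R m \<inter> ?R m' = {}" if "m \<noteq> m'" for m m'
  proof -
    have False if "h \<in> heads_le (n - m)" "w \<in> legal_words m" "h' \<in> heads_le (n - m')" "w' \<in> legal_words m'"
      "padded_block h (n - m) @ w = padded_block h' (n - m') @ w'" for h w h' w'
    proof -
      have "w = w'" using padded_block_append_inj[OF that(1,3,5) pos[OF that(2)] pos[OF that(4)]] by simp
      then show False using that(2,4) \<open>m \<noteq> m'\<close> by (simp add: legal_words_def)
    qed
    then have "x \<notin> ?R m'" if "x \<in> ?R m" for x using that by (elim imageE) (auto, metis)
    then show ?thesis by (simp add: disjoint_iff)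
  qed
  have "(\<Sum>w\<in>legal_words n. f w) = sum f ?P + sum f ?B + sum f (\<Union>m\<in>{..n}. ?R m)"
    unfolding legal_words_eq[of n] using fin PB PR by (simp add: sum.union_disjoint)
  also have "sum f ?B = (\<Sum>h\<in>heads_le n. f (padded_block h n))"
    by (subst sum.reindex) (use inj0[of _ n _ n "[]"] in \<open>auto intro!: inj_onI\<close>)
  also have "sum f (\<Union>m\<in>{..n}. ?R m) = (\<Sum>m\<le>n. sum f (?R m))"
    using fin RR by (intro sum.UNION_disjoint) auto
  also have "\<dots> = (\<Sum>m\<le>n. \<Sum>w\<in>legal_words m. \<Sum>h\<in>heads_le (n - m). f (padded_block h (n - m) @ w))"
  proof (rule sum.cong[OF refl])
    fix m
    have "inj_on (\<lambda>(h, w). padded_block h (n - m) @ w) (heads_le (n - m) \<times> legal_words m)"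
    proof (rule inj_onI, clarify)
      fix s t w s' t' w'
      assume "(s, t) \<in> heads_le (n - m)" "w \<in> legal_words m"
        "(s', t') \<in> heads_le (n - m)" "w' \<in> legal_words m"
        "padded_block (s, t) (n - m) @ w = padded_block (s', t') (n - m) @ w'"
      then show "(s, t) = (s', t') \<and> w = w'"
        using padded_block_append_inj[OF _ _ _ pos pos] by blast
    qed
    then have "sum f (?R m) =
        (\<Sum>(h, w)\<in>heads_le (n - m) \<times> legal_words m. f (padded_block h (n - m) @ w))"
      by (subst sum.reindex) (auto simp: case_prod_unfold)
    also have "\<dots> = (\<Sum>h\<in>heads_le (n - m). \<Sum>w\<in>legal_words m. f (padded_block h (n - m) @ w))"
      by (simp add: sum.cartesian_product)
    also have "\<dots> = (\<Sum>w\<in>legal_words m. \<Sum>h\<in>heads_le (n - m). f (padded_block h (n - m) @ w))"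
      by (rule sum.swap)
    finally show "sum f (?R m) =
        (\<Sum>w\<in>legal_words m. \<Sum>h\<in>heads_le (n - m). f (padded_block h (n - m) @ w))" .
  qed
  finally show ?thesis .
qed

text \<open>
  The gaps equal to \<open>g\<close> that start inside a padded block when another block follows. The last
  summand of the block lies at the digit \<open>t\<close> if \<open>t > 0\<close>, and one digit before it otherwise.
\<close>

definition block_gaps :: "nat \<Rightarrow> nat \<times> nat \<Rightarrow> nat \<Rightarrow> nat" where
  "block_gaps g h j = word_gap_count g (block h) +
     (if (if snd h = 0 then 2 else 1) + (j - Suc (fst h)) = g then 1 else 0)"

text \<open>If the final digit is 0, the digit before it is a coefficient, hence positive. So the
  last summand never lies further back, whatever preceded.\<close>

lemma last_summand_indices_block:
  assumes "h \<in> heads"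
  shows "summand_indices (block h) \<noteq> [] \<and>
    last (summand_indices (block h)) = (if snd h = 0 then 2 else 1)"
proof (cases "snd h = 0")
  case True
  then obtain s where s: "fst h = Suc s" using headsD(3)[OF assms] by (cases "fst h") auto
  then have "block h = take s cs @ [cs ! s, 0]" "cs ! s > 0"
    using headsD[OF assms] positive True by (auto simp: block_def take_Suc_conv_app_nth)
  then show ?thesis using True by (simp add: summand_indices_append)
qed (simp add: block_def summand_indices_append)

lemma word_gap_count_padded_block: "word_gap_count g (padded_block h j) = word_gap_count g (block h)"
  by (simp add: padded_block_def word_gap_count_append_zeros)

text \<open>The gap leading out of the padded block does not depend on \<open>w\<close>, which makes
  the count additive.\<close>

lemma word_gap_count_padded_block_append:
  assumes "h \<in> heads_le j" "legal cs w"
  shows "word_gap_count g (padded_block h j @ w) = block_gaps g h j + word_gap_count g w"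
proof -
  have h: "h \<in> heads" using assms by (simp add: heads_le_def)
  have "summand_indices (padded_block h j) \<noteq> [] \<and> last (summand_indices (padded_block h j)) =
      (if snd h = 0 then 2 else 1) + (j - Suc (fst h))"
    using last_summand_indices_block[OF h] by (simp add: padded_block_def summand_indices_append last_map)
  then show ?thesis
    using word_gap_count_append[of "padded_block h j" w g] legal_hd[OF assms(2)]
    by (simp add: block_gaps_def word_gap_count_padded_block)
qed

end

section \<open>Moments of the gap count\<close>

lemma variance_pmf_of_set_shift:
  fixes f :: "'a \<Rightarrow> real"
  assumes "finite S" "S \<noteq> {}"
  shows "measure_pmf.variance (pmf_of_set S) f =
    (\<Sum>x\<in>S. (f x - a)\<^sup>2) / card S - ((\<Sum>x\<in>S. f x - a) / card S)\<^sup>2"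
proof -
  define N where "N = real (card S)"
  have N: "N > 0" using assms by (simp add: N_def card_gt_0_iff)
  define d where "d = (\<Sum>x\<in>S. f x - a) / N"
  have sum: "(\<Sum>x\<in>S. f x - a) = N * d" using N by (simp add: d_def)
  have mean: "measure_pmf.expectation (pmf_of_set S) f = d + a"
    using N assms by (simp add: integral_pmf_of_set d_def N_def sum_subtractf field_simps)
  have "measure_pmf.variance (pmf_of_set S) f = (\<Sum>x\<in>S. (f x - (d + a))\<^sup>2) / N"
    unfolding mean using assms by (simp add: integral_pmf_of_set N_def)
  also have "(\<Sum>x\<in>S. (f x - (d + a))\<^sup>2) = (\<Sum>x\<in>S. (f x - a)\<^sup>2 - 2 * d * (f x - a) + d\<^sup>2)"
    by (intro sum.cong refl) (simp add: power2_eq_square algebra_simps)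
  also have "\<dots> = (\<Sum>x\<in>S. (f x - a)\<^sup>2) - 2 * d * (\<Sum>x\<in>S. f x - a) + N * d\<^sup>2"
    by (simp only: sum.distrib sum_subtractf[of "\<lambda>x. (f x - a)\<^sup>2"] sum_distrib_left N_def sum_constant)
  also have "\<dots> / N = (\<Sum>x\<in>S. (f x - a)\<^sup>2) / N - d\<^sup>2"
    unfolding sum using N by (simp add: field_simps power2_eq_square)
  finally show ?thesis by (simp add: d_def N_def)
qed

context positive_plrs
begin

definition centered :: "nat \<Rightarrow> real \<Rightarrow> nat list \<Rightarrow> real" where
  "centered g \<mu> w = real (word_gap_count g w) - \<mu> * real (length w)"

definition block_weight :: "nat \<Rightarrow> real \<Rightarrow> nat \<Rightarrow> nat \<times> nat \<Rightarrow> real" where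
  "block_weight g \<mu> j h = real (block_gaps g h j) - \<mu> * real j"

definition word_moment :: "nat \<Rightarrow> real \<Rightarrow> nat \<Rightarrow> nat \<Rightarrow> real" where
  "word_moment g \<mu> i n = (\<Sum>w\<in>legal_words n. centered g \<mu> w ^ i)"

definition block_moment :: "nat \<Rightarrow> real \<Rightarrow> nat \<Rightarrow> nat \<Rightarrow> real" where
  "block_moment g \<mu> i j = (\<Sum>h\<in>heads_le j. block_weight g \<mu> j h ^ i)"

text \<open>The words that no further block follows; no gap leads out of them, so
  \<open>block_gaps\<close> would overcount.\<close>

definition last_moment :: "nat \<Rightarrow> real \<Rightarrow> nat \<Rightarrow> nat \<Rightarrow> real" where
  "last_moment g \<mu> i n = (\<Sum>w\<in>prefix_words n. centered g \<mu> w ^ i) +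
     (\<Sum>h\<in>heads_le n. centered g \<mu> (padded_block h n) ^ i)"

lemma centered_append:
  assumes "m \<le> n" "h \<in> heads_le (n - m)" "w \<in> legal_words m"
  shows "centered g \<mu> (padded_block h (n - m) @ w) = block_weight g \<mu> (n - m) h + centered g \<mu> w"
  using assms word_gap_count_padded_block_append[of h "n - m" w g]
  by (auto simp: centered_def block_weight_def legal_words_def length_padded_block algebra_simps)

lemma word_moment_eq:
  "word_moment g \<mu> i n = last_moment g \<mu> i n +
    (\<Sum>m\<le>n. \<Sum>w\<in>legal_words m. \<Sum>h\<in>heads_le (n - m).
       (block_weight g \<mu> (n - m) h + centered g \<mu> w) ^ i)"
  unfolding word_moment_def last_moment_def
  by (subst sum_legal_words) (simp add: centered_append)

text \<open>For exponents 0, 1 and 2, binomial expansion separates the block from the remaining word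
  and yields the convolutions of \<open>renewal_variance\<close>.\<close>

lemma word_moment_0:
  "word_moment g \<mu> 0 n = last_moment g \<mu> 0 n
     + (\<Sum>m\<le>n. block_moment g \<mu> 0 (n - m) * word_moment g \<mu> 0 m)"
  unfolding word_moment_eq[of g \<mu> 0 n] by (simp add: block_moment_def word_moment_def mult.commute)

lemma word_moment_1:
  "word_moment g \<mu> 1 n = last_moment g \<mu> 1 n
     + (\<Sum>m\<le>n. block_moment g \<mu> 1 (n - m) * word_moment g \<mu> 0 m)
     + (\<Sum>m\<le>n. block_moment g \<mu> 0 (n - m) * word_moment g \<mu> 1 m)"
  unfolding word_moment_eq[of g \<mu> 1 n]
  by (simp add: block_moment_def word_moment_def sum.distrib mult.commute
      flip: sum_distrib_left sum_distrib_right)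

lemma word_moment_2:
  "word_moment g \<mu> 2 n = last_moment g \<mu> 2 n
     + (\<Sum>m\<le>n. block_moment g \<mu> 2 (n - m) * word_moment g \<mu> 0 m)
     + (\<Sum>m\<le>n. 2 * block_moment g \<mu> 1 (n - m) * word_moment g \<mu> 1 m)
     + (\<Sum>m\<le>n. block_moment g \<mu> 0 (n - m) * word_moment g \<mu> 2 m)"
  unfolding word_moment_eq[of g \<mu> 2 n]
  by (simp add: block_moment_def word_moment_def sum.distrib power2_sum mult.commute
      mult.left_commute flip: sum_distrib_left sum_distrib_right)

lemma word_gap_count_block_le:
  assumes "h \<in> heads"
  shows "word_gap_count g (block h) \<le> 2 * sum_list cs"
proof -
  have "sum_list (take (fst h) cs) \<le> sum_list cs"
    by (metis append_take_drop_id le_add1 sum_list_append)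
  moreover have "snd h \<le> sum_list cs"
    using headsD[OF assms] elem_le_sum_list[of "fst h" cs] by simp
  ultimately show ?thesis using word_gap_count_le[of g "block h"] by (simp add: block_def)
qed

lemma moments_quadratic_growth:
  assumes "i \<le> 2"
  obtains c where "\<And>j. \<bar>block_moment g \<mu> i j\<bar> \<le> c * (real j + 1)\<^sup>2"
    "\<And>j. \<bar>last_moment g \<mu> i j\<bar> \<le> c * (real j + 1)\<^sup>2"
proof -
  \<comment> \<open>A block has at most \<open>2 * sum_list cs\<close> gaps, one more may lead out,
    and each digit costs \<open>\<mu>\<close>. As \<open>b \<ge> 1\<close>, exponents below 2 can be
    raised to 2.\<close>
  define b where "b = 2 * real (sum_list cs) + 1 + \<bar>\<mu>\<bar>"
  define H where "H = real (card heads)"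
  have pow: "\<bar>x ^ i\<bar> \<le> b\<^sup>2 * (real j + 1)\<^sup>2" if "\<bar>x\<bar> \<le> b * (real j + 1)" for x j
  proof -
    have "1 \<le> b * (real j + 1)"
      using mult_mono[of 1 b 1 "real j + 1"] by (simp add: b_def)
    have "\<bar>x ^ i\<bar> \<le> (b * (real j + 1)) ^ i" using that by (simp add: power_abs power_mono)
    also have "\<dots> \<le> (b * (real j + 1)) ^ 2"
      by (rule power_increasing) fact+
    finally show ?thesis by (simp add: power_mult_distrib)
  qed
  have lin: "\<bar>real k - \<mu> * real j\<bar> \<le> b * (real j + 1)" if "k \<le> 2 * sum_list cs + 1" for k j
  proof -
    have "\<bar>real k - \<mu> * real j\<bar> \<le> real k + \<bar>\<mu>\<bar> * real j"
      by (metis abs_mult abs_of_nat abs_triangle_ineq4)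
    also have "\<dots> \<le> (2 * real (sum_list cs) + 1) + \<bar>\<mu>\<bar> * real j" using that by linarith
    also have "\<dots> \<le> b * (real j + 1)" by (simp add: b_def algebra_simps)
    finally show ?thesis .
  qed
  have card: "real (card (heads_le j)) \<le> H" for j
    using card_mono[OF finite_heads, of "heads_le j"] by (auto simp: H_def heads_le_def)
  have sum: "\<bar>\<Sum>h\<in>heads_le j. F h ^ i\<bar> \<le> H * (b\<^sup>2 * (real j + 1)\<^sup>2)"
    if "\<And>h. h \<in> heads_le j \<Longrightarrow> \<bar>F h\<bar> \<le> b * (real j + 1)" for F j
  proof -
    have "\<bar>\<Sum>h\<in>heads_le j. F h ^ i\<bar> \<le> (\<Sum>h\<in>heads_le j. \<bar>F h ^ i\<bar>)" by (rule sum_abs)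
    also have "\<dots> \<le> real (card (heads_le j)) * (b\<^sup>2 * (real j + 1)\<^sup>2)"
      by (rule sum_bounded_above) (use pow that in auto)
    also have "\<dots> \<le> H * (b\<^sup>2 * (real j + 1)\<^sup>2)" by (rule mult_right_mono[OF card]) simp
    finally show ?thesis .
  qed
  have prefix: "\<bar>\<Sum>w\<in>prefix_words j. centered g \<mu> w ^ i\<bar> \<le> b\<^sup>2 * (real j + 1)\<^sup>2" for j
  proof (cases "0 < j \<and> j < length cs")
    case True
    have "sum_list (take j cs) \<le> sum_list cs"
      by (metis append_take_drop_id le_add1 sum_list_append)
    then have "word_gap_count g (take j cs) \<le> 2 * sum_list cs + 1"
      using word_gap_count_le[of g "take j cs"] by simp
    from pow[OF lin[OF this]] True show ?thesis by (simp add: prefix_words_def centered_def)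
  qed (auto simp: prefix_words_def)
  show ?thesis
  proof (rule that)
    fix j
    have bg: "block_gaps g h j \<le> 2 * sum_list cs + 1" if "h \<in> heads_le j" for h
      using word_gap_count_block_le[of h g] that by (simp add: block_gaps_def heads_le_def)
    have "\<bar>block_moment g \<mu> i j\<bar> \<le> H * (b\<^sup>2 * (real j + 1)\<^sup>2)"
      unfolding block_moment_def block_weight_def by (intro sum lin bg)
    also have "\<dots> \<le> (1 + H) * b\<^sup>2 * (real j + 1)\<^sup>2" by (simp add: algebra_simps)
    finally show "\<bar>block_moment g \<mu> i j\<bar> \<le> (1 + H) * b\<^sup>2 * (real j + 1)\<^sup>2" .
    have cen: "\<bar>centered g \<mu> (padded_block h j)\<bar> \<le> b * (real j + 1)" if "h \<in> heads_le j" for h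
      using lin[of "word_gap_count g (block h)" j] word_gap_count_block_le[of h g] that
      by (simp add: centered_def length_padded_block word_gap_count_padded_block heads_le_def)
    show "\<bar>last_moment g \<mu> i j\<bar> \<le> (1 + H) * b\<^sup>2 * (real j + 1)\<^sup>2"
      using prefix[of j] sum[of j "\<lambda>h. centered g \<mu> (padded_block h j)", OF cen]
      unfolding last_moment_def by (simp add: algebra_simps)
  qed
qed

lemma exp_small_moments:
  assumes "0 < \<rho>" "\<rho> < 1" "i \<le> 2"
  shows "exp_small (\<lambda>j. block_moment g \<mu> i j * \<rho> ^ j)"
    "exp_small (\<lambda>j. last_moment g \<mu> i j * \<rho> ^ j)"
  by (rule moments_quadratic_growth[OF assms(3)],
      rule exp_small_quadratic_growth[OF assms(1,2)], assumption)+

section \<open>Normalization and nondegeneracy of the block weights\<close>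

text \<open>The equation says that the generating function of the blocks is 1 at
  \<open>\<rho>\<close>, cleared of its denominator. \<open>?f\<close> rises from 0 to more than 1
  on the unit interval.\<close>

lemma growth_rate_exists:
  assumes "heads \<noteq> {}"
  obtains \<rho> :: real where "0 < \<rho>" "\<rho> < 1" "(\<Sum>h\<in>heads. \<rho> ^ Suc (fst h)) = 1 - \<rho>"
proof -
  let ?f = "\<lambda>x::real. (\<Sum>h\<in>heads. x ^ Suc (fst h)) + x"
  have H: "real (card heads) > 0" using assms finite_heads by (simp add: card_gt_0_iff)
  have "\<exists>x\<ge>0. x \<le> 1 \<and> ?f x = 1"
    by (rule IVT') (use H in \<open>auto intro!: continuous_intros\<close>)
  then obtain x where x: "0 \<le> x" "x \<le> 1" "?f x = 1" by blast
  moreover have "x \<noteq> 0" "x \<noteq> 1" using x(3) H by (auto intro!: notI)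
  ultimately show ?thesis using that[of x] by simp
qed

lemma block_moment_0: "block_moment g \<mu> 0 j = real (card (heads_le j))"
  by (simp add: block_moment_def)

text \<open>Padding gives each head every length from \<open>Suc (fst h)\<close> on, so it
  contributes a geometric series.\<close>

lemma sums_block_moment_0:
  assumes "0 < \<rho>" "\<rho> < 1" "(\<Sum>h\<in>heads. \<rho> ^ Suc (fst h)) = 1 - \<rho>"
  shows "(\<lambda>j. block_moment g \<mu> 0 j * \<rho> ^ j) sums 1"
proof -
  have "(\<lambda>j. \<Sum>h\<in>heads. if Suc (fst h) \<le> j then \<rho> ^ j else 0) sums
      (\<Sum>h\<in>heads. \<rho> ^ Suc (fst h) / (1 - \<rho>))"
    by (intro sums_sum sums_geometric_from assms)
  moreover have "(\<Sum>h\<in>heads. \<rho> ^ Suc (fst h) / (1 - \<rho>)) = 1"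
    unfolding sum_divide_distrib[symmetric] assms(3) using assms by simp
  moreover have "(\<Sum>h\<in>heads. if Suc (fst h) \<le> j then \<rho> ^ j else 0) = block_moment g \<mu> 0 j * \<rho> ^ j" for j
    using finite_heads by (simp add: block_moment_0 heads_le_def flip: sum.inter_filter)
  ultimately show ?thesis by simp
qed

lemma word_gap_count_eq_0:
  assumes bw: "\<And>h j. h \<in> heads_le j \<Longrightarrow> block_weight g \<mu> j h = 0"
    and "legal cs w"
  shows "word_gap_count g w = 0"
proof -
  have mu: "\<mu> = 0" if h: "h \<in> heads" for h
  proof -
    \<comment> \<open>Long enough that the gap leading out exceeds \<open>g\<close>: one more zero
      then changes the length but not the count, so \<open>\<mu> = 0\<close>.\<close>
    define j where "j = Suc (Suc (fst h)) + g"
    have "h \<in> heads_le j" "h \<in> heads_le (Suc j)" using h by (auto simp: heads_le_def j_def)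
    moreover have "block_gaps g h (Suc j) = block_gaps g h j" by (simp add: block_gaps_def j_def)
    ultimately show "\<mu> = 0" using bw[of h j] bw[of h "Suc j"] by (simp add: block_weight_def algebra_simps)
  qed
  have gaps0: "block_gaps g h j = 0" if "h \<in> heads_le j" for h j
    using bw[OF that] mu[of h] that by (simp add: block_weight_def heads_le_def)
  have blk: "word_gap_count g (block h) = 0" if "h \<in> heads" for h
    using gaps0[of h "Suc (fst h)"] that by (simp add: block_gaps_def heads_le_def split: if_splits)
  show ?thesis
    using assms(2)
  proof (induction "length w" arbitrary: w rule: less_induct)
    case less
    from less.prems show ?case
    proof (cases rule: legal_cases)
      case 1
      \<comment> \<open>The next coefficient being positive, a proper prefix of \<open>cs\<close>
        followed by a 0 is a block, and the 0 does not affect gaps.\<close>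
      have "(length w, 0) \<in> heads" using 1 positive[of "length w"] by (simp add: heads_def)
      moreover have "block (length w, 0) = w @ replicate 1 0" using 1 by (simp add: block_def)
      ultimately show ?thesis using blk[of "(length w, 0)"] word_gap_count_append_zeros[of g w 1] by simp
    next
      case (2 h j v)
      have h: "h \<in> heads" using 2 by (simp add: heads_le_def)
      show ?thesis
      proof (cases "v = []")
        case True
        then show ?thesis using 2 blk[OF h] by (simp add: word_gap_count_padded_block)
      next
        case False
        moreover have "length v < length w" using 2 by (simp add: length_padded_block heads_le_def)
        ultimately show ?thesis
          using 2 gaps0[OF 2(1)] less.hyps[of v] by (simp add: word_gap_count_padded_block_append)
      qed
    qed
  qed
qed

lemma gap_variance_eq:
  assumes "n > 0" "plrs_interval cs n \<noteq> {}"
  shows "gap_variance cs g n = word_moment g \<mu> 2 n / word_moment g \<mu> 0 n -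
    (word_moment g \<mu> 1 n / word_moment g \<mu> 0 n)\<^sup>2"
proof -
  have "finite (plrs_interval cs n)" by (simp add: plrs_interval_def)
  note var = variance_pmf_of_set_shift[OF this assms(2), of "\<lambda>M. real (gap_count cs g M)" "\<mu> * real n"]
  have bij: "bij_betw (decomp_value cs) (legal_words n) (plrs_interval cs n)"
    by (rule bij_betw_decomp_value) fact
  have sum: "(\<Sum>M\<in>plrs_interval cs n. (real (gap_count cs g M) - \<mu> * real n) ^ i) = word_moment g \<mu> i n" for i
    unfolding word_moment_def
    by (subst sum.reindex_bij_betw[OF bij, symmetric])
       (auto intro!: sum.cong simp: gap_count_eq legal_words_def legal_decomp_decomp_value centered_def)
  have card: "real (card (plrs_interval cs n)) = word_moment g \<mu> 0 n" using sum[of 0] by simp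
  show ?thesis unfolding gap_variance_def var card using sum[of 2] sum[of 1] by simp
qed

lemma gap_variance_asymptotics:
  assumes "\<And>n. n \<ge> n0 \<Longrightarrow> gap_nontrivial cs g n"
  shows "\<exists>C d. C > 0 \<and> exp_small (\<lambda>n. gap_variance cs g n - (C * real n + d))"
proof -
  \<comment> \<open>\<open>Suc n0\<close> rather than \<open>n0\<close>, because the bijection with
    words needs a positive index.\<close>
  have "gap_nontrivial cs g (Suc n0)" using assms by simp
  then obtain M where M: "M \<in> plrs_interval cs (Suc n0)" "gap_count cs g M \<noteq> 0"
    by (auto simp: gap_nontrivial_def)
  obtain v where "v \<in> legal_words (Suc n0)" "decomp_value cs v = M"
    using bij_betw_decomp_value[of "Suc n0"] M by (metis bij_betw_imp_surj_on imageE zero_less_Suc)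
  then have v: "legal cs v" "word_gap_count g v \<noteq> 0"
    using M by (auto simp: legal_words_def gap_count_eq legal_decomp_decomp_value)
  \<comment> \<open>Without heads, all block weights vanish vacuously, and \<open>v\<close> could
    not contain a gap \<open>g\<close>.\<close>
  have "heads \<noteq> {}"
  proof
    assume "heads = {}"
    then have "\<And>h j. h \<in> heads_le j \<Longrightarrow> block_weight g 0 j h = 0" by (simp add: heads_le_def)
    from word_gap_count_eq_0[OF this v(1)] v(2) show False by simp
  qed
  then obtain h0 where h0: "h0 \<in> heads" by blast
  \<comment> \<open>Padding makes both \<open>k\<close> and \<open>Suc k\<close> lengths of blocks,
    which supplies the aperiodicity.\<close>
  define k where "k = Suc (fst h0)"
  have card_pos: "card (heads_le j) > 0" if "k \<le> j" for j
  proof -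
    have "h0 \<in> heads_le j" using h0 that by (simp add: heads_le_def k_def)
    then show ?thesis by (auto simp: card_gt_0_iff)
  qed
  obtain \<rho> :: real where \<rho>: "0 < \<rho>" "\<rho> < 1" "(\<Sum>h\<in>heads. \<rho> ^ Suc (fst h)) = 1 - \<rho>"
    using growth_rate_exists[OF \<open>heads \<noteq> {}\<close>] .
  note small = exp_small_moments[OF \<rho>(1,2)]
  define q where "q = (\<lambda>\<mu> i. scaled_fps \<rho> (block_moment g \<mu> i))"
  define T where "T = (\<lambda>\<mu> i. scaled_fps \<rho> (last_moment g \<mu> i))"
  define N where "N = (\<lambda>\<mu> i. scaled_fps \<rho> (word_moment g \<mu> i))"
  have eval: "eval_fps (scaled_fps \<rho> f) 1 = (\<Sum>j. f j * \<rho> ^ j)" for f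
    by (simp add: eval_fps_one)
  \<comment> \<open>The terms of the mean length of a block under the distribution normalized by
    \<open>\<rho>\<close>.\<close>
  define len where "len = (\<lambda>j. real j * (block_moment g 0 0 j * \<rho> ^ j))"
  have len: "summable len" unfolding len_def
    by (intro exp_small_summable exp_small_mult_nat small) simp
  have "suminf len > 0"
    by (rule suminf_pos2[OF len, of k])
       (use card_pos[of k] \<rho> in \<open>auto simp: len_def block_moment_0 k_def\<close>)
  \<comment> \<open>Mean number of gaps per block over mean length: the centering for which the mean
    block weight is 0.\<close>
  define \<mu> where "\<mu> = (\<Sum>j. block_moment g 0 1 j * \<rho> ^ j) / suminf len"
  have "(\<lambda>j. block_moment g \<mu> 1 j * \<rho> ^ j) = (\<lambda>j. block_moment g 0 1 j * \<rho> ^ j - \<mu> * len j)"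
    by (auto simp: block_moment_def block_weight_def len_def sum_subtractf algebra_simps)
  moreover have "(\<Sum>j. block_moment g 0 1 j * \<rho> ^ j - \<mu> * len j) =
      (\<Sum>j. block_moment g 0 1 j * \<rho> ^ j) - \<mu> * suminf len"
    using len by (subst suminf_diff[symmetric])
      (auto intro!: exp_small_summable small simp: suminf_mult summable_mult)
  ultimately have q1: "eval_fps (q \<mu> 1) 1 = 0"
    using \<open>suminf len > 0\<close> by (simp add: q_def eval \<mu>_def)
  have q2: "eval_fps (q \<mu> 2) 1 > 0"
  proof (rule ccontr)
    assume neg: "\<not> eval_fps (q \<mu> 2) 1 > 0"
    let ?f = "\<lambda>j. block_moment g \<mu> 2 j * \<rho> ^ j"
    have nn: "?f j \<ge> 0" for j using \<rho> by (auto simp: block_moment_def intro!: mult_nonneg_nonneg sum_nonneg)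
    have sf: "summable ?f" by (intro exp_small_summable small) simp
    then have "suminf ?f = 0" using neg suminf_nonneg[OF sf nn] by (simp add: q_def eval)
    then have "?f j = 0" for j using suminf_eq_zero_iff[OF sf nn] by simp
    then have "block_moment g \<mu> 2 j = 0" for j using \<rho> by simp
    then have "block_weight g \<mu> j h = 0" if "h \<in> heads_le j" for j h
      using that sum_nonneg_eq_0_iff[of "heads_le j" "\<lambda>h. block_weight g \<mu> j h ^ 2"]
      by (simp add: block_moment_def)
    from word_gap_count_eq_0[OF this v(1)] v(2) show False by simp
  qed
  have T0: "eval_fps (T \<mu> 0) 1 > 0"
  proof -
    have "last_moment g \<mu> 0 j \<ge> real (card (heads_le j))" for j by (simp add: last_moment_def)
    then have "last_moment g \<mu> 0 j \<ge> 0" "last_moment g \<mu> 0 k > 0" for j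
      using card_pos[of k] by (meson of_nat_0_le_iff of_nat_0_less_iff order_trans less_le_trans order_refl)+
    moreover have "summable (\<lambda>j. last_moment g \<mu> 0 j * \<rho> ^ j)"
      by (intro exp_small_summable small) simp
    ultimately show ?thesis
      using \<rho> unfolding T_def eval by (intro suminf_pos2[of _ k]) auto
  qed
  have radius: "fps_conv_radius (q \<mu> i) > 1" "fps_conv_radius (T \<mu> i) > 1" if "i \<le> 2" for i
    using small[OF that] by (auto simp: q_def T_def scaled_fps_def simp flip: exp_small_iff_Abs_fps)
  have scaled: "scaled_fps \<rho> (\<lambda>n. a n + b n) = scaled_fps \<rho> a + scaled_fps \<rho> b" for a b
    by (rule fps_ext) (simp add: algebra_simps)
  have N0: "N \<mu> 0 = T \<mu> 0 + q \<mu> 0 * N \<mu> 0"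
    unfolding N_def T_def q_def scaled_fps_convolution scaled[symmetric] word_moment_0[symmetric] ..
  have N1: "N \<mu> 1 = T \<mu> 1 + q \<mu> 1 * N \<mu> 0 + q \<mu> 0 * N \<mu> 1"
    unfolding N_def T_def q_def scaled_fps_convolution scaled[symmetric] word_moment_1[symmetric] ..
  have two: "2 * q \<mu> 1 = scaled_fps \<rho> (\<lambda>j. 2 * block_moment g \<mu> 1 j)"
    by (rule fps_ext) (simp add: q_def fps_mult_numeral_left)
  have N2: "N \<mu> 2 = T \<mu> 2 + q \<mu> 2 * N \<mu> 0 + 2 * q \<mu> 1 * N \<mu> 1 + q \<mu> 0 * N \<mu> 2"
    unfolding two
    unfolding N_def T_def q_def scaled_fps_convolution scaled[symmetric] word_moment_2[symmetric] ..
  have "\<exists>C d. C > 0 \<and> exp_small (\<lambda>n. fps_nth (N \<mu> 2) n / fps_nth (N \<mu> 0) n -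
      (fps_nth (N \<mu> 1) n / fps_nth (N \<mu> 0) n)\<^sup>2 - (C * real n + d))"
  proof (rule renewal_variance[OF _ _ _ _ _ _ N0 N1 N2, where k = k])
    show "eval_fps (q \<mu> 0) 1 = 1" unfolding q_def eval
      using sums_block_moment_0[OF \<rho>] by (simp add: sums_iff)
    show "fps_nth (q \<mu> 0) 0 = 0" by (simp add: q_def block_moment_0 heads_le_def)
    show "fps_nth (q \<mu> 0) n \<ge> 0" for n using \<rho> by (simp add: q_def block_moment_0)
    show "fps_nth (q \<mu> 0) k > 0" "fps_nth (q \<mu> 0) (Suc k) > 0"
      using \<rho> card_pos[of k] card_pos[of "Suc k"] by (auto simp: q_def block_moment_0)
  qed (use radius q1 q2 T0 in auto)
  then obtain C d where C: "C > 0" and ex: "exp_small (\<lambda>n. fps_nth (N \<mu> 2) n / fps_nth (N \<mu> 0) n -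
      (fps_nth (N \<mu> 1) n / fps_nth (N \<mu> 0) n)\<^sup>2 - (C * real n + d))" by blast
  have "fps_nth (N \<mu> 2) n / fps_nth (N \<mu> 0) n - (fps_nth (N \<mu> 1) n / fps_nth (N \<mu> 0) n)\<^sup>2 =
      gap_variance cs g n" if n: "n \<ge> Suc n0" for n
  proof -
    have "gap_nontrivial cs g n" using assms n by simp
    then have "plrs_interval cs n \<noteq> {}" by (auto simp: gap_nontrivial_def)
    then show ?thesis using gap_variance_eq[of n g \<mu>] n \<rho> by (simp add: N_def)
  qed
  then have ev: "eventually (\<lambda>n. fps_nth (N \<mu> 2) n / fps_nth (N \<mu> 0) n -
      (fps_nth (N \<mu> 1) n / fps_nth (N \<mu> 0) n)\<^sup>2 - (C * real n + d) =
      gap_variance cs g n - (C * real n + d)) at_top"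
    by (intro eventually_sequentiallyI[of "Suc n0"]) simp
  have "exp_small (\<lambda>n. gap_variance cs g n - (C * real n + d))"
    using ex landau_o.big.in_cong[OF ev] by (auto simp: exp_small_def)
  with C show ?thesis by blast
qed

end

theorem theorem1p7:
  fixes g :: nat and cs :: "nat list"
  assumes "plrs_coeffs cs"
    and "\<forall>i \<in> {1..length cs}. cs ! (i - 1) > 0"
    and "\<exists>n0. \<forall>n \<ge> n0. gap_nontrivial cs g n"
  shows "\<exists>C d \<gamma> :: real. C > 0 \<and> 0 < \<gamma> \<and> \<gamma> < 1 \<and>
           (\<lambda>n. gap_variance cs g n - (C * real n + d)) \<in> O(\<lambda>n. \<gamma> ^ n)"
proof -
  interpret positive_plrs cs
  proof
    show "cs \<noteq> []" using assms(1) by (auto simp: plrs_coeffs_def)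
    show "cs ! i > 0" if "i < length cs" for i
      using that bspec[OF assms(2), of "Suc i"] by simp
  qed
  obtain n0 where "\<And>n. n \<ge> n0 \<Longrightarrow> gap_nontrivial cs g n" using assms(3) by blast
  then show ?thesis using gap_variance_asymptotics[of n0 g] unfolding exp_small_def by blast
qed

end
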